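(* Let $G$ be a non-virtually cyclic finitely generated group that has a central infinite cyclic subgroup $H$. Then $G$ is wide, i.e. none of the asymptotic cones of $G$ has a global cut-point.
   Context: Asymptotic cones. For a metric space $(X,\mathrm{dist})$, a non-principal ultrafilter $\omega$ over a countable set $I$, points $e=(e_n)_{n\in I}$ of $X$ and positive numbers $d=(d_n)_{n\in I}$ with $\lim_\omega d_n=\infty$, the asymptotic cone $\mathrm{Con}^\omega(X;e,d)$ is the set of sequences $(x_n)$ in $X$ with $\lim_\omega \mathrm{dist}(x_n,e_n)/d_n<\infty$, with pseudo-distance $\lim_\omega \mathrm{dist}(x_n,y_n)/d_n$, modulo pseudo-distance $0$. For a finitely generated group one uses a word metric and $e=(1)$. A global cut-point of a space $Y$ is a point whose complement in $Y$ is not path connected; by convention a one-point space has a cut-point. *)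

theory Defs
  imports "HOL-Analysis.Analysis" "HOL-Algebra.Elementary_Groups"
begin

section \<open>Ultrafilters\<close>

text \<open>A filter on the index type \<open>'i\<close> is a value of type \<open>'i filter\<close>; a set \<open>A\<close> is a
  member of \<open>F\<close> iff \<open>eventually (\<lambda>i. i \<in> A) F\<close>.\<close>

definition ultrafilter :: "'i filter \<Rightarrow> bool" where
  "ultrafilter F \<longleftrightarrow> F \<noteq> bot \<and> (\<forall>P. eventually P F \<or> eventually (\<lambda>i. \<not> P i) F)"

definition nonprincipal_ultrafilter :: "'i filter \<Rightarrow> bool" where
  "nonprincipal_ultrafilter F \<longleftrightarrow> ultrafilter F \<and> (\<nexists>i. F = principal {i})"

lemma ultrafilter_bounded_limit:
  fixes f :: "'i \<Rightarrow> real"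
  assumes "ultrafilter F" and "eventually (\<lambda>i. a \<le> f i \<and> f i \<le> b) F"
  shows "\<exists>L. (f \<longlongrightarrow> L) F"
proof -
  have "filtermap f F \<noteq> bot" "eventually (\<lambda>x. x \<in> {a..b}) (filtermap f F)"
    using assms by (auto simp: ultrafilter_def filtermap_bot_iff eventually_filtermap)
  then obtain L where L: "inf (nhds L) (filtermap f F) \<noteq> bot"
    using compact_Icc[of a b] unfolding compact_filter by blast
  have "filtermap f F \<le> nhds L"
  proof (rule filter_leI)
    fix P assume P: "eventually P (nhds L)"
    show "eventually P (filtermap f F)"
    proof (rule ccontr)
      assume "\<not> eventually P (filtermap f F)"
      then have "eventually (\<lambda>x. \<not> P x) (filtermap f F)"
        using assms(1) unfolding ultrafilter_def eventually_filtermap by blast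
      with P have "eventually (\<lambda>_. False) (inf (nhds L) (filtermap f F))"
        unfolding eventually_inf by blast
      with L show False by simp
    qed
  qed
  then show ?thesis by (auto simp: filterlim_def)
qed


section \<open>Asymptotic cones\<close>

text \<open>The condition that the limit of \<open>dist(x\<^sub>i, e\<^sub>i) / d\<^sub>i\<close> along the ultrafilter is finite is
  expressed by convergence to some real number.\<close>

definition cone_sequences ::
    "'a set \<Rightarrow> ('a \<Rightarrow> 'a \<Rightarrow> real) \<Rightarrow> 'i filter \<Rightarrow> ('i \<Rightarrow> 'a) \<Rightarrow> ('i \<Rightarrow> real) \<Rightarrow> ('i \<Rightarrow> 'a) set" where
  "cone_sequences M dst \<omega> e d =
     {x. (\<forall>i. x i \<in> M) \<and> (\<exists>L. ((\<lambda>i. dst (x i) (e i) / d i) \<longlongrightarrow> L) \<omega>)}"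

definition cone_pdist ::
    "('a \<Rightarrow> 'a \<Rightarrow> real) \<Rightarrow> 'i filter \<Rightarrow> ('i \<Rightarrow> real) \<Rightarrow> ('i \<Rightarrow> 'a) \<Rightarrow> ('i \<Rightarrow> 'a) \<Rightarrow> real" where
  "cone_pdist dst \<omega> d x y = Lim \<omega> (\<lambda>i. dst (x i) (y i) / d i)"

definition cone_rel ::
    "'a set \<Rightarrow> ('a \<Rightarrow> 'a \<Rightarrow> real) \<Rightarrow> 'i filter \<Rightarrow> ('i \<Rightarrow> 'a) \<Rightarrow> ('i \<Rightarrow> real)
      \<Rightarrow> (('i \<Rightarrow> 'a) \<times> ('i \<Rightarrow> 'a)) set" where
  "cone_rel M dst \<omega> e d =
     {(x, y). x \<in> cone_sequences M dst \<omega> e d \<and> y \<in> cone_sequences M dst \<omega> e d \<and>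
              cone_pdist dst \<omega> d x y = 0}"

definition asymptotic_cone ::
    "'a set \<Rightarrow> ('a \<Rightarrow> 'a \<Rightarrow> real) \<Rightarrow> 'i filter \<Rightarrow> ('i \<Rightarrow> 'a) \<Rightarrow> ('i \<Rightarrow> real) \<Rightarrow> ('i \<Rightarrow> 'a) set set" where
  "asymptotic_cone M dst \<omega> e d = cone_sequences M dst \<omega> e d // cone_rel M dst \<omega> e d"

text \<open>The value \<open>0\<close> off the carrier is junk; it is there because \<^locale>\<open>Metric_space\<close> asks for
  nonnegativity and symmetry on the whole type.\<close>

definition cone_dist ::
    "'a set \<Rightarrow> ('a \<Rightarrow> 'a \<Rightarrow> real) \<Rightarrow> 'i filter \<Rightarrow> ('i \<Rightarrow> 'a) \<Rightarrow> ('i \<Rightarrow> real)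
      \<Rightarrow> ('i \<Rightarrow> 'a) set \<Rightarrow> ('i \<Rightarrow> 'a) set \<Rightarrow> real" where
  "cone_dist M dst \<omega> e d A B =
     (if A \<in> asymptotic_cone M dst \<omega> e d \<and> B \<in> asymptotic_cone M dst \<omega> e d
      then the_elem (\<Union>x\<in>A. \<Union>y\<in>B. {cone_pdist dst \<omega> d x y}) else 0)"

definition cone_topology ::
    "'a set \<Rightarrow> ('a \<Rightarrow> 'a \<Rightarrow> real) \<Rightarrow> 'i filter \<Rightarrow> ('i \<Rightarrow> 'a) \<Rightarrow> ('i \<Rightarrow> real)
      \<Rightarrow> ('i \<Rightarrow> 'a) set topology" where
  "cone_topology M dst \<omega> e d =
     Metric_space.mtopology (asymptotic_cone M dst \<omega> e d) (cone_dist M dst \<omega> e d)"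

context
  fixes M :: "'a set" and dst :: "'a \<Rightarrow> 'a \<Rightarrow> real"
    and \<omega> :: "'i filter" and e :: "'i \<Rightarrow> 'a" and d :: "'i \<Rightarrow> real"
  assumes M: "Metric_space M dst" and ultra: "ultrafilter \<omega>"
    and e: "\<And>i. e i \<in> M" and d: "\<And>i. 0 < d i"
begin

interpretation Metric_space M dst by (rule M)

lemma cone_pdist_tendsto:
  assumes "x \<in> cone_sequences M dst \<omega> e d" "y \<in> cone_sequences M dst \<omega> e d"
  shows "((\<lambda>i. dst (x i) (y i) / d i) \<longlongrightarrow> cone_pdist dst \<omega> d x y) \<omega>"
proof -
  have nb: "\<omega> \<noteq> bot" using ultra by (simp add: ultrafilter_def)
  obtain L L' where LM: "((\<lambda>i. dst (x i) (e i) / d i) \<longlongrightarrow> L) \<omega>"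
      "((\<lambda>i. dst (y i) (e i) / d i) \<longlongrightarrow> L') \<omega>"
    and xy: "\<And>i. x i \<in> M" "\<And>i. y i \<in> M"
    using assms by (auto simp: cone_sequences_def)
  have ev: "eventually (\<lambda>i. dst (x i) (e i) / d i + dst (y i) (e i) / d i < L + L' + 1) \<omega>"
    by (rule order_tendstoD(2)[OF tendsto_add[OF LM]]) simp
  have "eventually (\<lambda>i. 0 \<le> dst (x i) (y i) / d i \<and> dst (x i) (y i) / d i \<le> L + L' + 1) \<omega>"
    using ev
  proof eventually_elim
    case (elim i)
    have "dst (x i) (y i) \<le> dst (x i) (e i) + dst (y i) (e i)"
      using triangle[OF xy(1) e xy(2)] commute by metis
    then have "dst (x i) (y i) / d i \<le> (dst (x i) (e i) + dst (y i) (e i)) / d i"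
      using d[of i] by (intro divide_right_mono) auto
    with elim d[of i] show ?case by (simp add: add_divide_distrib less_imp_le)
  qed
  then obtain l where "((\<lambda>i. dst (x i) (y i) / d i) \<longlongrightarrow> l) \<omega>"
    using ultrafilter_bounded_limit[OF ultra, of 0 "\<lambda>i. dst (x i) (y i) / d i"] by meson
  then show ?thesis by (simp add: cone_pdist_def tendsto_Lim nb)
qed

lemma cone_pdist_props:
  assumes "x \<in> cone_sequences M dst \<omega> e d" "y \<in> cone_sequences M dst \<omega> e d"
  shows "0 \<le> cone_pdist dst \<omega> d x y" "cone_pdist dst \<omega> d y x = cone_pdist dst \<omega> d x y"
    and "cone_pdist dst \<omega> d x x = 0"
    and "z \<in> cone_sequences M dst \<omega> e d \<Longrightarrow>
      cone_pdist dst \<omega> d x z \<le> cone_pdist dst \<omega> d x y + cone_pdist dst \<omega> d y z"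
proof -
  have nb: "\<omega> \<noteq> bot" using ultra by (simp add: ultrafilter_def)
  show "0 \<le> cone_pdist dst \<omega> d x y"
    by (rule tendsto_lowerbound[OF cone_pdist_tendsto[OF assms] _ nb])
       (simp add: d less_imp_le always_eventually)
  show "cone_pdist dst \<omega> d y x = cone_pdist dst \<omega> d x y"
    by (simp add: cone_pdist_def commute)
  have "\<And>i. x i \<in> M" using assms(1) by (auto simp: cone_sequences_def)
  then have "(\<lambda>i. dst (x i) (x i) / d i) = (\<lambda>i. 0)"
    by simp
  then show "cone_pdist dst \<omega> d x x = 0"
    using cone_pdist_tendsto[OF assms(1) assms(1)] tendsto_unique[OF nb]
    by (metis tendsto_const)
  assume z: "z \<in> cone_sequences M dst \<omega> e d"
  have mem: "\<And>i. x i \<in> M" "\<And>i. y i \<in> M" "\<And>i. z i \<in> M"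
    using assms z by (auto simp: cone_sequences_def)
  show "cone_pdist dst \<omega> d x z \<le> cone_pdist dst \<omega> d x y + cone_pdist dst \<omega> d y z"
  proof (rule tendsto_le[OF nb])
    show "((\<lambda>i. dst (x i) (y i) / d i + dst (y i) (z i) / d i) \<longlongrightarrow>
        cone_pdist dst \<omega> d x y + cone_pdist dst \<omega> d y z) \<omega>"
      by (intro tendsto_add cone_pdist_tendsto assms z)
    show "((\<lambda>i. dst (x i) (z i) / d i) \<longlongrightarrow> cone_pdist dst \<omega> d x z) \<omega>"
      by (intro cone_pdist_tendsto assms z)
    show "eventually (\<lambda>i. dst (x i) (z i) / d i \<le> dst (x i) (y i) / d i + dst (y i) (z i) / d i) \<omega>"
      using triangle[OF mem] d
      by (intro always_eventually allI) (simp add: divide_right_mono less_imp_le flip: add_divide_distrib)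
  qed
qed

lemma equiv_cone_rel: "equiv (cone_sequences M dst \<omega> e d) (cone_rel M dst \<omega> e d)"
proof (rule equivI)
  show "cone_rel M dst \<omega> e d \<subseteq> cone_sequences M dst \<omega> e d \<times> cone_sequences M dst \<omega> e d"
    by (auto simp: cone_rel_def)
  show "refl_on (cone_sequences M dst \<omega> e d) (cone_rel M dst \<omega> e d)"
    by (auto simp: refl_on_def cone_rel_def cone_pdist_props)
  show "sym (cone_rel M dst \<omega> e d)"
    by (auto simp: sym_def cone_rel_def cone_pdist_props)
  show "trans (cone_rel M dst \<omega> e d)"
  proof (rule transI)
    fix x y z assume "(x, y) \<in> cone_rel M dst \<omega> e d" "(y, z) \<in> cone_rel M dst \<omega> e d"
    then show "(x, z) \<in> cone_rel M dst \<omega> e d"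
      using cone_pdist_props(1)[of x z] cone_pdist_props(4)[of x y z]
      by (auto simp: cone_rel_def)
  qed
qed

lemma cone_dist_class:
  assumes x: "x \<in> cone_sequences M dst \<omega> e d" and y: "y \<in> cone_sequences M dst \<omega> e d"
  shows "cone_dist M dst \<omega> e d (cone_rel M dst \<omega> e d `` {x}) (cone_rel M dst \<omega> e d `` {y})
    = cone_pdist dst \<omega> d x y"
proof -
  have "cone_pdist dst \<omega> d x' y' = cone_pdist dst \<omega> d x y"
    if "(x, x') \<in> cone_rel M dst \<omega> e d" "(y, y') \<in> cone_rel M dst \<omega> e d" for x' y'
  proof -
    have mem: "x' \<in> cone_sequences M dst \<omega> e d" "y' \<in> cone_sequences M dst \<omega> e d"
      and z: "cone_pdist dst \<omega> d x x' = 0" "cone_pdist dst \<omega> d y y' = 0"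
      using that by (auto simp: cone_rel_def)
    show ?thesis
      using cone_pdist_props(4)[OF x mem(1) mem(2)] cone_pdist_props(4)[OF x mem(2) y]
        cone_pdist_props(4)[OF mem(1) x mem(2)] cone_pdist_props(4)[OF x y mem(2)]
        cone_pdist_props(2)[OF x mem(1)] cone_pdist_props(2)[OF y mem(2)] z
      by linarith
  qed
  moreover have "(x, x) \<in> cone_rel M dst \<omega> e d" "(y, y) \<in> cone_rel M dst \<omega> e d"
    using x y by (auto simp: cone_rel_def cone_pdist_props)
  ultimately have "(\<Union>x'\<in>cone_rel M dst \<omega> e d `` {x}. \<Union>y'\<in>cone_rel M dst \<omega> e d `` {y}.
      {cone_pdist dst \<omega> d x' y'}) = {cone_pdist dst \<omega> d x y}"
    unfolding Image_singleton by blast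
  then show ?thesis
    using x y by (simp add: cone_dist_def asymptotic_cone_def quotientI)
qed

lemma Metric_space_cone:
  "Metric_space (asymptotic_cone M dst \<omega> e d) (cone_dist M dst \<omega> e d)"
proof -
  let ?C = "asymptotic_cone M dst \<omega> e d" and ?D = "cone_dist M dst \<omega> e d"
  let ?S = "cone_sequences M dst \<omega> e d" and ?R = "cone_rel M dst \<omega> e d"
  have rep: "\<exists>x\<in>?S. A = ?R `` {x}" if "A \<in> ?C" for A
    using that by (auto simp: asymptotic_cone_def elim: quotientE)
  have off: "?D A B = 0" if "\<not> (A \<in> ?C \<and> B \<in> ?C)" for A B
    using that by (auto simp: cone_dist_def)
  show ?thesis
  proof
    fix A B
    show "0 \<le> ?D A B"
    proof (cases "A \<in> ?C \<and> B \<in> ?C")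
      case True
      then obtain x y where "x \<in> ?S" "y \<in> ?S" "A = ?R `` {x}" "B = ?R `` {y}"
        using rep by blast
      then show ?thesis by (simp only: cone_dist_class cone_pdist_props(1))
    next
      case False
      then show ?thesis using off[of A B] off[of B A] by auto
    qed
    show "?D A B = ?D B A"
    proof (cases "A \<in> ?C \<and> B \<in> ?C")
      case True
      then obtain x y where "x \<in> ?S" "y \<in> ?S" "A = ?R `` {x}" "B = ?R `` {y}"
        using rep by blast
      then show ?thesis by (simp only: cone_dist_class cone_pdist_props(2))
    next
      case False
      then show ?thesis using off[of A B] off[of B A] by auto
    qed
  next
    fix A B assume "A \<in> ?C" "B \<in> ?C"
    then obtain x y where "x \<in> ?S" "y \<in> ?S" "A = ?R `` {x}" "B = ?R `` {y}"
      using rep by blast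
    then show "?D A B = 0 \<longleftrightarrow> A = B"
      using eq_equiv_class_iff[OF equiv_cone_rel, of x y]
      by (auto simp: cone_dist_class) (auto simp: cone_rel_def)
  next
    fix A B C assume "A \<in> ?C" "B \<in> ?C" "C \<in> ?C"
    then obtain x y z where "x \<in> ?S" "y \<in> ?S" "z \<in> ?S"
      "A = ?R `` {x}" "B = ?R `` {y}" "C = ?R `` {z}"
      using rep by meson
    then show "?D A C \<le> ?D A B + ?D B C"
      by (simp add: cone_dist_class cone_pdist_props(4))
  qed
qed

end


section \<open>Global cut-points\<close>

text \<open>The second disjunct is the convention that a one-point space has a cut-point; it is not
  covered by the first one, since the empty set is path connected in the library.\<close>

definition has_global_cut_point :: "'a topology \<Rightarrow> bool" where
  "has_global_cut_point Y \<longleftrightarrow>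
     (\<exists>y\<in>topspace Y. \<not> path_connectedin Y (topspace Y - {y}) \<or> topspace Y = {y})"


section \<open>Finitely generated groups and word metrics\<close>

definition generates :: "('g, 'b) monoid_scheme \<Rightarrow> 'g set \<Rightarrow> bool" where
  "generates G S \<longleftrightarrow> S \<subseteq> carrier G \<and> generate G S = carrier G"

definition finitely_generated_group :: "('g, 'b) monoid_scheme \<Rightarrow> bool" where
  "finitely_generated_group G \<longleftrightarrow> group G \<and> (\<exists>S. finite S \<and> generates G S)"

definition virtually_cyclic :: "('g, 'b) monoid_scheme \<Rightarrow> bool" where
  "virtually_cyclic G \<longleftrightarrow>
     (\<exists>K. subgroup K G \<and> cyclic_group (G\<lparr>carrier := K\<rparr>) \<and> finite (rcosets\<^bsub>G\<^esub> K))"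

definition word_length :: "('g, 'b) monoid_scheme \<Rightarrow> 'g set \<Rightarrow> 'g \<Rightarrow> nat" where
  "word_length G S g =
     (LEAST n. \<exists>ws. length ws = n \<and> set ws \<subseteq> S \<union> m_inv G ` S \<and> foldr (\<otimes>\<^bsub>G\<^esub>) ws \<one>\<^bsub>G\<^esub> = g)"

text \<open>The left-invariant word metric; the value \<open>0\<close> off the carrier is junk, as above.\<close>

definition word_dist :: "('g, 'b) monoid_scheme \<Rightarrow> 'g set \<Rightarrow> 'g \<Rightarrow> 'g \<Rightarrow> real" where
  "word_dist G S g h =
     (if g \<in> carrier G \<and> h \<in> carrier G then real (word_length G S (inv\<^bsub>G\<^esub> g \<otimes>\<^bsub>G\<^esub> h)) else 0)"

context
  fixes G :: "('g, 'b) monoid_scheme" and S :: "'g set"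
  assumes G: "group G" and S: "generates G S"
begin

interpretation group G by (rule G)

lemma word_closed:
  assumes "set ws \<subseteq> S \<union> m_inv G ` S"
  shows "foldr (\<otimes>\<^bsub>G\<^esub>) ws \<one>\<^bsub>G\<^esub> \<in> carrier G"
  using assms S by (induction ws) (auto simp: generates_def)

lemma word_append:
  assumes "set us \<subseteq> S \<union> m_inv G ` S" "set vs \<subseteq> S \<union> m_inv G ` S"
  shows "foldr (\<otimes>\<^bsub>G\<^esub>) (us @ vs) \<one>\<^bsub>G\<^esub> = foldr (\<otimes>\<^bsub>G\<^esub>) us \<one>\<^bsub>G\<^esub> \<otimes>\<^bsub>G\<^esub> foldr (\<otimes>\<^bsub>G\<^esub>) vs \<one>\<^bsub>G\<^esub>"
  using assms(1)
proof (induction us)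
  case Nil
  show ?case using word_closed[OF assms(2)] by simp
next
  case (Cons u us)
  have "u \<in> carrier G" using Cons.prems S by (auto simp: generates_def)
  with Cons show ?case
    using word_closed[OF assms(2)] word_closed[of us] by (simp add: m_assoc)
qed

lemma word_inverse:
  assumes "set ws \<subseteq> S \<union> m_inv G ` S"
  shows "\<exists>vs. length vs = length ws \<and> set vs \<subseteq> S \<union> m_inv G ` S \<and>
    foldr (\<otimes>\<^bsub>G\<^esub>) vs \<one>\<^bsub>G\<^esub> = inv\<^bsub>G\<^esub> foldr (\<otimes>\<^bsub>G\<^esub>) ws \<one>\<^bsub>G\<^esub>"
  using assms
proof (induction ws)
  case Nil
  show ?case by simp
next
  case (Cons w ws)
  then obtain vs where vs: "length vs = length ws" "set vs \<subseteq> S \<union> m_inv G ` S"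
    "foldr (\<otimes>\<^bsub>G\<^esub>) vs \<one>\<^bsub>G\<^esub> = inv\<^bsub>G\<^esub> foldr (\<otimes>\<^bsub>G\<^esub>) ws \<one>\<^bsub>G\<^esub>" by auto
  have w: "w \<in> carrier G" using Cons.prems S by (auto simp: generates_def)
  have iw: "set [inv\<^bsub>G\<^esub> w] \<subseteq> S \<union> m_inv G ` S"
    using Cons.prems S by (auto simp: generates_def subset_iff)
  have "foldr (\<otimes>\<^bsub>G\<^esub>) (vs @ [inv\<^bsub>G\<^esub> w]) \<one>\<^bsub>G\<^esub> = inv\<^bsub>G\<^esub> foldr (\<otimes>\<^bsub>G\<^esub>) (w # ws) \<one>\<^bsub>G\<^esub>"
    unfolding word_append[OF vs(2) iw]
    using vs(3) w word_closed[of ws] Cons.prems by (simp add: inv_mult_group)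
  with vs iw show ?case
    by (intro exI[of _ "vs @ [inv\<^bsub>G\<^esub> w]"]) simp
qed

lemma word_exists:
  assumes "g \<in> carrier G"
  shows "\<exists>ws. set ws \<subseteq> S \<union> m_inv G ` S \<and> foldr (\<otimes>\<^bsub>G\<^esub>) ws \<one>\<^bsub>G\<^esub> = g"
proof -
  have "g \<in> generate G S" using assms S by (simp add: generates_def)
  then show ?thesis
  proof (induction rule: generate.induct)
    case one
    show ?case by (rule exI[of _ "[]"]) simp
  next
    case (incl h)
    then show ?case using S by (intro exI[of _ "[h]"]) (auto simp: generates_def)
  next
    case (inv h)
    then show ?case using S by (intro exI[of _ "[inv\<^bsub>G\<^esub> h]"]) (auto simp: generates_def)
  next
    case (eng g h)
    then obtain us vs where "set us \<subseteq> S \<union> m_inv G ` S" "foldr (\<otimes>\<^bsub>G\<^esub>) us \<one>\<^bsub>G\<^esub> = g"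
      "set vs \<subseteq> S \<union> m_inv G ` S" "foldr (\<otimes>\<^bsub>G\<^esub>) vs \<one>\<^bsub>G\<^esub> = h" by blast
    then show ?case using word_append[of us vs] by (intro exI[of _ "us @ vs"]) auto
  qed
qed

lemma word_length_le:
  assumes "set ws \<subseteq> S \<union> m_inv G ` S" "foldr (\<otimes>\<^bsub>G\<^esub>) ws \<one>\<^bsub>G\<^esub> = g"
  shows "word_length G S g \<le> length ws"
  unfolding word_length_def using assms by (intro Least_le) auto

lemma word_length_attained:
  assumes "g \<in> carrier G"
  shows "\<exists>ws. length ws = word_length G S g \<and> set ws \<subseteq> S \<union> m_inv G ` S \<and>
    foldr (\<otimes>\<^bsub>G\<^esub>) ws \<one>\<^bsub>G\<^esub> = g"
proof -
  have "\<exists>n ws. length ws = n \<and> set ws \<subseteq> S \<union> m_inv G ` S \<and> foldr (\<otimes>\<^bsub>G\<^esub>) ws \<one>\<^bsub>G\<^esub> = g"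
    using word_exists[OF assms] by blast
  then show ?thesis unfolding word_length_def by (rule LeastI_ex)
qed

lemma word_length_inv_le:
  assumes "g \<in> carrier G"
  shows "word_length G S (inv\<^bsub>G\<^esub> g) \<le> word_length G S g"
  using word_length_attained[OF assms] word_inverse word_length_le by metis

lemma word_length_mult_le:
  assumes "g \<in> carrier G" "h \<in> carrier G"
  shows "word_length G S (g \<otimes>\<^bsub>G\<^esub> h) \<le> word_length G S g + word_length G S h"
proof -
  obtain us vs where u: "length us = word_length G S g" "set us \<subseteq> S \<union> m_inv G ` S"
      "foldr (\<otimes>\<^bsub>G\<^esub>) us \<one>\<^bsub>G\<^esub> = g"
    and v: "length vs = word_length G S h" "set vs \<subseteq> S \<union> m_inv G ` S"
      "foldr (\<otimes>\<^bsub>G\<^esub>) vs \<one>\<^bsub>G\<^esub> = h"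
    using word_length_attained assms by meson
  have "word_length G S (g \<otimes>\<^bsub>G\<^esub> h) \<le> length (us @ vs)"
    by (rule word_length_le) (use u v word_append in auto)
  with u v show ?thesis by simp
qed

lemma word_length_eq_0:
  assumes "g \<in> carrier G"
  shows "word_length G S g = 0 \<longleftrightarrow> g = \<one>\<^bsub>G\<^esub>"
  using word_length_attained[OF assms] word_length_le[of "[]" "\<one>\<^bsub>G\<^esub>"] by auto

lemma Metric_space_word_dist: "Metric_space (carrier G) (word_dist G S)"
proof
  fix g h
  show "0 \<le> word_dist G S g h" by (simp add: word_dist_def)
  have "word_length G S (inv\<^bsub>G\<^esub> a \<otimes>\<^bsub>G\<^esub> b) \<le> word_length G S (inv\<^bsub>G\<^esub> b \<otimes>\<^bsub>G\<^esub> a)"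
    if "a \<in> carrier G" "b \<in> carrier G" for a b
    using word_length_inv_le[of "inv\<^bsub>G\<^esub> b \<otimes>\<^bsub>G\<^esub> a"] that by (simp add: inv_mult_group)
  then show "word_dist G S g h = word_dist G S h g"
    by (auto simp: word_dist_def intro: antisym)
next
  fix g h assume "g \<in> carrier G" "h \<in> carrier G"
  then show "word_dist G S g h = 0 \<longleftrightarrow> g = h"
    by (simp add: word_dist_def word_length_eq_0) (metis inv_equality inv_inv l_inv inv_closed)
next
  fix a b c assume m: "a \<in> carrier G" "b \<in> carrier G" "c \<in> carrier G"
  have "inv\<^bsub>G\<^esub> a \<otimes>\<^bsub>G\<^esub> c = (inv\<^bsub>G\<^esub> a \<otimes>\<^bsub>G\<^esub> b) \<otimes>\<^bsub>G\<^esub> (inv\<^bsub>G\<^esub> b \<otimes>\<^bsub>G\<^esub> c)"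
    using m by (metis inv_closed inv_solve_left m_assoc m_closed)
  then show "word_dist G S a c \<le> word_dist G S a b + word_dist G S b c"
    using m word_length_mult_le[of "inv\<^bsub>G\<^esub> a \<otimes>\<^bsub>G\<^esub> b" "inv\<^bsub>G\<^esub> b \<otimes>\<^bsub>G\<^esub> c"]
    by (simp add: word_dist_def flip: of_nat_add)
qed

end


section \<open>Wide groups\<close>

text \<open>The asymptotic cones of a group range over all finite generating sets, all non-principal
  ultrafilters and all scaling sequences. The countable index set is a type \<open>'i\<close>; as a
  definition cannot quantify over types, it is passed as an argument, and a statement with a free
  type variable \<open>'i\<close> covers every countable index set.\<close>

definition wide :: "'i::countable itself \<Rightarrow> ('g, 'b) monoid_scheme \<Rightarrow> bool" where
  "wide TYPE('i) G \<longleftrightarrow>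
     (\<forall>S (\<omega> :: 'i filter) d.
        finite S \<and> generates G S \<and> nonprincipal_ultrafilter \<omega> \<and>
        (\<forall>i. 0 < d i) \<and> filterlim d at_top \<omega> \<longrightarrow>
        \<not> has_global_cut_point (cone_topology (carrier G) (word_dist G S) \<omega> (\<lambda>_. \<one>\<^bsub>G\<^esub>) d))"

end

theory Submission
  imports Defs
begin

text \<open>
  Multiplication by a sequence in the central subgroup \<open>H\<close> is an isometry of the asymptotic cone,
  which is a geodesic space. These translations form a group \<open>T\<close>. Let \<open>p\<close> and \<open>q\<close> be two points
  different from \<open>y\<close>. To join them in the complement of \<open>y\<close>, take a geodesic from \<open>p\<close> to \<open>q\<close>, and if
  it runs through \<open>y\<close>, push it off \<open>y\<close> by a translation \<open>t\<close> for which \<open>t p\<close> and \<open>t q\<close> can still be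
  joined to \<open>p\<close> and \<open>q\<close> without meeting \<open>y\<close>.

  Suppose that \<open>p\<close> and \<open>q\<close> are outside the orbit of \<open>y\<close> under \<open>T\<close>. The translations that do not move
  \<open>p\<close> and \<open>q\<close> out of their path components in the complement of the orbit form a group, which contains
  all small translations. If none of them pushes the geodesic off \<open>y\<close>, then they move \<open>y\<close> within the
  geodesic. But a bounded set of reals on which a group of isometries acts transitively has at most
  two points (\<open>homogeneous_bounded_real_set\<close>). There are small translations of every
  size, because the lengths of elements of \<open>H\<close> fill the half-line up to a bounded error
  (\<open>infinite_cyclic_subgroup_lengths\<close>), and this is a contradiction (\<open>joined_off_orbit\<close>).

  It remains to move a point of the orbit, other than \<open>y\<close>, out of the orbit (\<open>escape_orbit\<close>). This is
  where \<open>G\<close> is not virtually cyclic: as \<open>H\<close> has infinite index, there are elements \<open>g\<close> of every length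
  such that \<open>\<one>\<close> is a nearest point to \<open>g\<close> in \<open>H\<close> (\<open>infinite_index_far_elements\<close>), and geodesics in
  the direction of such elements meet the orbit only at the start.
\<close>

section \<open>Geodesic spaces with many translations\<close>

text \<open>The eccentricity of a point, its largest distance to the other points, is
  \<open>max (q - Inf P) (Sup P - q)\<close>. On a homogeneous set it is a constant \<open>c\<close>, so every point is
  either \<open>Inf P + c\<close> or \<open>Sup P - c\<close>.\<close>

lemma homogeneous_bounded_real_set:
  fixes P :: "real set"
  assumes bdd: "P \<subseteq> {a..b}"
    and hom: "\<And>p q p'. p \<in> P \<Longrightarrow> q \<in> P \<Longrightarrow> p' \<in> P \<Longrightarrow> \<exists>q'\<in>P. \<bar>q - q'\<bar> = \<bar>p - p'\<bar>"
  shows "\<exists>u v. P \<subseteq> {u, v}"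
proof (cases "P = {}")
  case False
  then obtain p0 where p0: "p0 \<in> P" by blast
  define E where "E = (\<lambda>p'. \<bar>p0 - p'\<bar>) ` P"
  define c where "c = Sup E"
  have E: "E = (\<lambda>p'. \<bar>q - p'\<bar>) ` P" if "q \<in> P" for q
  proof (intro equalityI subsetI)
    fix r assume "r \<in> E"
    then obtain p' where "p' \<in> P" "r = \<bar>p0 - p'\<bar>" by (auto simp: E_def)
    then show "r \<in> (\<lambda>p'. \<bar>q - p'\<bar>) ` P" using hom[OF p0 that, of p'] by force
  next
    fix r assume "r \<in> (\<lambda>p'. \<bar>q - p'\<bar>) ` P"
    then obtain p' where "p' \<in> P" "r = \<bar>q - p'\<bar>" by auto
    then show "r \<in> E" using hom[OF that p0, of p'] unfolding E_def by force
  qed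
  have bE: "bdd_above E"
  proof (rule bdd_aboveI[of _ "b - a"])
    fix r assume "r \<in> E"
    then obtain p where "p \<in> P" "r = \<bar>p0 - p\<bar>" by (auto simp: E_def)
    moreover have "p \<in> {a..b}" "p0 \<in> {a..b}" using \<open>p \<in> P\<close> bdd p0 by blast+
    ultimately show "r \<le> b - a" by auto
  qed
  have bP: "bdd_above P" "bdd_below P"
    using bdd by (meson bdd_above_Icc bdd_above_mono bdd_below_Icc bdd_below_mono)+
  have "q = Inf P + c \<or> q = Sup P - c" if q: "q \<in> P" for q
  proof (rule ccontr)
    assume neq: "\<not> ?thesis"
    have near: "\<bar>q - p\<bar> \<le> c" if "p \<in> P" for p
      unfolding c_def using that bE by (intro cSup_upper) (auto simp: E[OF q])
    have "q - c \<le> Inf P"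
      using False near by (intro cInf_greatest) fastforce+
    moreover have "Sup P \<le> q + c"
      using False near by (intro cSup_least) fastforce+
    ultimately have "max (q - Inf P) (Sup P - q) < c" using neq by auto
    moreover have "c \<le> max (q - Inf P) (Sup P - q)"
      unfolding c_def
    proof (rule cSup_least)
      show "E \<noteq> {}" using p0 by (simp add: E_def) blast
      fix r assume "r \<in> E"
      then obtain p where "p \<in> P" "r = \<bar>q - p\<bar>" using E[OF q] by blast
      then show "r \<le> max (q - Inf P) (Sup P - q)"
        using cInf_lower[OF _ bP(2), of p] cSup_upper[OF _ bP(1), of p] by linarith
    qed
    ultimately show False by linarith
  qed
  then show ?thesis by blast
qed auto

context Metric_space
begin

definition geodesic :: "(real \<Rightarrow> 'a) \<Rightarrow> 'a \<Rightarrow> 'a \<Rightarrow> bool" where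
  "geodesic g x y \<longleftrightarrow> g 0 = x \<and> g (d x y) = y \<and> g ` {0..d x y} \<subseteq> M \<and>
     (\<forall>s\<in>{0..d x y}. \<forall>t\<in>{0..d x y}. d (g s) (g t) = \<bar>s - t\<bar>)"

lemma geodesic_dist:
  assumes "geodesic g x y" "s \<in> {0..d x y}"
  shows "d x (g s) = s" "d (g s) y = d x y - s"
proof -
  have "d (g 0) (g s) = \<bar>0 - s\<bar>" "d (g s) (g (d x y)) = \<bar>s - d x y\<bar>"
    using assms unfolding geodesic_def by (meson atLeastAtMost_iff nonneg order_refl)+
  then show "d x (g s) = s" "d (g s) y = d x y - s"
    using assms by (auto simp: geodesic_def)
qed

text \<open>\<open>B\<close> is the obstacle: a path has to stay in \<open>M - B\<close>.\<close>

definition joined :: "'a set \<Rightarrow> 'a \<Rightarrow> 'a \<Rightarrow> bool" where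
  "joined B p q \<longleftrightarrow> path_component_of (subtopology mtopology (M - B)) p q"

lemma joined_sym: "joined B p q \<Longrightarrow> joined B q p"
  by (simp add: joined_def path_component_of_sym)

lemma joined_trans [trans]: "joined B p q \<Longrightarrow> joined B q r \<Longrightarrow> joined B p r"
  unfolding joined_def by (rule path_component_of_trans)

lemma joined_refl: "p \<in> M - B \<Longrightarrow> joined B p p"
  by (simp add: joined_def path_component_of_refl)

lemma joined_iff:
  "joined B p q \<longleftrightarrow> (\<exists>g. pathin mtopology g \<and> g ` {0..1} \<subseteq> M - B \<and> g 0 = p \<and> g 1 = q)"
  by (auto simp: joined_def path_component_of_def pathin_subtopology)

lemma joined_mono: "joined B p q \<Longrightarrow> B' \<subseteq> B \<Longrightarrow> joined B' p q"
  unfolding joined_iff by blast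

lemma joined_geodesic:
  assumes g: "geodesic g x y" and B: "\<And>s. s \<in> {0..d x y} \<Longrightarrow> g s \<notin> B"
  shows "joined B x y"
proof -
  let ?D = "d x y"
  have "pathin mtopology (\<lambda>u. g (u * ?D))"
    unfolding pathin_def continuous_map_to_metric
  proof (intro ballI allI impI)
    fix u e :: real assume u: "u \<in> topspace (top_of_set {0..1})" and e: "e > 0"
    let ?U = "{0..1} \<inter> ball u (e / (?D + 1))"
    have scale: "v * ?D \<in> {0..?D}" if "v \<in> {0..1}" for v
      using that by (auto simp: mult_left_le_one_le)
    have "openin (top_of_set {0..1}) ?U" by (simp add: openin_open_Int)
    moreover have "u \<in> ?U"
      using u e by (simp add: add_nonneg_pos)
    moreover have "g (v * ?D) \<in> mball (g (u * ?D)) e" if v: "v \<in> ?U" for v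
    proof -
      have "d (g (u * ?D)) (g (v * ?D)) = \<bar>u * ?D - v * ?D\<bar>"
        using g scale u v unfolding geodesic_def by auto
      also have "\<dots> = \<bar>u - v\<bar> * ?D" by (simp add: abs_mult flip: left_diff_distrib)
      also have "\<dots> \<le> \<bar>u - v\<bar> * (?D + 1)" by (simp add: mult_left_mono)
      also have "\<dots> < e"
        using v nonneg[of x y] by (simp add: dist_real_def field_simps add_nonneg_pos)
      finally show ?thesis
        using g scale u v unfolding geodesic_def by auto
    qed
    ultimately show "\<exists>U. openin (top_of_set {0..1}) U \<and> u \<in> U \<and>
        (\<forall>v\<in>U. g (v * ?D) \<in> mball (g (u * ?D)) e)"
      by blast
  qed
  moreover have "(\<lambda>u. g (u * ?D)) ` {0..1} \<subseteq> M - B"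
  proof -
    have "(\<lambda>u. g (u * ?D)) ` {0..1} \<subseteq> g ` {0..?D}"
      by (auto simp: mult_left_le_one_le)
    moreover have "g ` {0..?D} \<subseteq> M - B" using g B by (auto simp: geodesic_def)
    ultimately show ?thesis by (rule subset_trans)
  qed
  moreover have "g (0 * ?D) = x" "g (1 * ?D) = y" using g by (simp_all add: geodesic_def)
  ultimately show ?thesis unfolding joined_iff by blast
qed

text \<open>The hypothesis on \<open>B\<close> and \<open>B'\<close> says that \<open>f\<close> pulls the new obstacle back into the old one; so
  an isometry that preserves an orbit transports paths off this orbit, and a translation by \<open>t\<close>
  turns a path avoiding \<open>t y\<close> into one avoiding a preimage of this point.\<close>

lemma joined_isometry:
  assumes j: "joined B p q"
    and f: "\<And>x. x \<in> M \<Longrightarrow> f x \<in> M" "\<And>x y. x \<in> M \<Longrightarrow> y \<in> M \<Longrightarrow> d (f x) (f y) = d x y"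
    and B: "\<And>x. x \<in> M \<Longrightarrow> f x \<in> B' \<Longrightarrow> x \<in> B"
  shows "joined B' (f p) (f q)"
proof -
  obtain g where g: "pathin mtopology g" "g ` {0..1} \<subseteq> M - B" "g 0 = p" "g 1 = q"
    using j unfolding joined_iff by blast
  have "continuous_map mtopology mtopology f"
    unfolding continuous_map_to_metric
  proof (intro ballI allI impI)
    fix x e assume "x \<in> topspace mtopology" "(e::real) > 0"
    then show "\<exists>U. openin mtopology U \<and> x \<in> U \<and> (\<forall>y\<in>U. f y \<in> mball (f x) e)"
      using f by (intro exI[of _ "mball x e"]) auto
  qed
  then have "pathin mtopology (f \<circ> g)" using g(1) by (rule pathin_compose[rotated])
  then show ?thesis
    unfolding joined_iff using g f(1) B by (intro exI[of _ "f \<circ> g"]) auto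
qed

end

text \<open>The setting in which cut-points are excluded. Elements of \<open>T\<close> are functions on the whole type,
  so that \<open>T\<close> is a group only up to agreement on \<open>M\<close>. The assumption \<open>displacement\<close> provides
  translations of every size; as one map has the same displacement at all \<open>x\<close>, two given points can
  be moved by a small amount simultaneously. In \<open>transversal\<close>, \<open>x\<close> is a nearest point to \<open>w\<close> on the orbit
  of \<open>x\<close>, so that a geodesic from \<open>x\<close> to \<open>w\<close> leaves the orbit at once.\<close>

locale translated_geodesic_space = Metric_space M d for M :: "'a set" and d +
  fixes T :: "('a \<Rightarrow> 'a) set"
  assumes geodesic_exists: "x \<in> M \<Longrightarrow> y \<in> M \<Longrightarrow> \<exists>g. geodesic g x y"
    and maps: "f \<in> T \<Longrightarrow> x \<in> M \<Longrightarrow> f x \<in> M"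
    and isometry: "f \<in> T \<Longrightarrow> x \<in> M \<Longrightarrow> y \<in> M \<Longrightarrow> d (f x) (f y) = d x y"
    and composition: "f \<in> T \<Longrightarrow> g \<in> T \<Longrightarrow> \<exists>h\<in>T. \<forall>x\<in>M. h x = f (g x)"
    and inverse: "f \<in> T \<Longrightarrow> \<exists>g\<in>T. \<forall>x\<in>M. g (f x) = x \<and> f (g x) = x"
    and displacement: "r > 0 \<Longrightarrow> \<exists>f\<in>T. \<forall>x\<in>M. d x (f x) = r"
    and orbit_closed: "x \<in> M \<Longrightarrow> y \<in> M \<Longrightarrow> x \<notin> (\<lambda>f. f y) ` T \<Longrightarrow> \<exists>\<delta>>0. \<forall>f\<in>T. \<delta> \<le> d x (f y)"
    and transversal: "x \<in> M \<Longrightarrow> \<exists>w\<in>M. w \<noteq> x \<and> (\<forall>f\<in>T. d x w \<le> d w (f x))"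
begin

abbreviation orbit :: "'a \<Rightarrow> 'a set" where
  "orbit y \<equiv> (\<lambda>f. f y) ` T"

lemma orbit_self:
  assumes "y \<in> M" shows "y \<in> orbit y"
proof -
  obtain f g where "f \<in> T" "g \<in> T" "g (f y) = y"
    using displacement[of 1] inverse assms by force
  moreover obtain h where "h \<in> T" "\<forall>x\<in>M. h x = g (f x)"
    using composition[OF \<open>g \<in> T\<close> \<open>f \<in> T\<close>] by blast
  ultimately have "y = h y" using assms by simp
  then show ?thesis using \<open>h \<in> T\<close> by (rule image_eqI)
qed

lemma orbit_invariant:
  assumes "f \<in> T" "x \<in> M" "y \<in> M" "f x \<in> orbit y"
  shows "x \<in> orbit y"
proof -
  obtain g h where gh: "g \<in> T" "g (f x) = x" "h \<in> T" "f x = h y"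
    using assms inverse by blast
  then obtain k where "k \<in> T" "k y = g (h y)" using composition[of g h] assms(3) by blast
  with gh show ?thesis by (metis image_eqI)
qed

text \<open>Only a point \<open>x\<close> of the orbit of \<open>y\<close> needs to be moved. Then \<open>x\<close> is the only point of the
  orbit on a geodesic from \<open>x\<close> to a transversal point \<open>w\<close>: a point at distance \<open>s > 0\<close>
  from \<open>x\<close> is closer to \<open>w\<close> than the orbit is.\<close>

lemma escape_orbit:
  assumes x: "x \<in> M" "x \<noteq> y" and y: "y \<in> M"
  shows "\<exists>w\<in>M. w \<notin> orbit y \<and> joined {y} x w"
proof (cases "x \<in> orbit y")
  case False
  then show ?thesis using x joined_refl[of x "{y}"] by blast
next
  case True
  then obtain f where f: "f \<in> T" "x = f y" by blast
  then obtain f' where f': "f' \<in> T" "f' x = y" using inverse y by blast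
  obtain w where w: "w \<in> M" "w \<noteq> x" "\<forall>f\<in>T. d x w \<le> d w (f x)"
    using transversal x by blast
  obtain g where g: "geodesic g x w" using geodesic_exists x w by blast
  have "w \<notin> orbit y"
  proof
    assume "w \<in> orbit y"
    then obtain h where "h \<in> T" "w = h (f' x)" using f' by auto
    then obtain k where "k \<in> T" "k x = w" using composition[of h f'] f' x by auto
    then have "d x w \<le> d w w" using w by blast
    then show False using w x nonneg[of x w] by (metis mdist_zero mdist_pos_less not_less)
  qed
  moreover have "g s \<noteq> y" if s: "s \<in> {0..d x w}" for s
  proof
    assume "g s = y"
    moreover have "d x w \<le> d w y" using w(3) f' by blast
    ultimately have "s = 0" using geodesic_dist(2)[OF g s] s by (simp add: commute)
    then show False using \<open>g s = y\<close> g x by (simp add: geodesic_def)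
  qed
  then have "joined {y} x w" by (intro joined_geodesic[OF g]) blast
  ultimately show ?thesis using w by blast
qed

text \<open>Let \<open>S\<close> consist of the \<open>t\<close> in \<open>T\<close> that move neither \<open>p\<close> nor \<open>q\<close> out of its path component
  in the complement of the orbit of \<open>y\<close>. It is a group because the complement is \<open>T\<close>-invariant, and
  it contains all sufficiently small translations because the orbit is closed. Let \<open>g\<close> be a
  geodesic from \<open>p\<close> to \<open>q\<close>. If \<open>g\<close> misses \<open>t y\<close> for some \<open>t\<close> in \<open>S\<close>, then the translate of \<open>g\<close>
  by \<open>t\<inverse>\<close> misses \<open>y\<close> and \<open>p\<close> and \<open>q\<close> are joined through it. Otherwise the orbit of \<open>y\<close>
  under \<open>S\<close> lies on \<open>g\<close>, which makes it isometric to a bounded homogeneous set of reals; such a set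
  has at most two points, whereas \<open>S\<close> moves \<open>y\<close> by infinitely many different distances.\<close>

lemma joined_off_orbit:
  assumes y: "y \<in> M" and p: "p \<in> M" "p \<notin> orbit y" and q: "q \<in> M" "q \<notin> orbit y"
  shows "joined {y} p q"
proof (rule ccontr)
  assume contr: "\<not> joined {y} p q"
  define S where "S = {t\<in>T. joined (orbit y) p (t p) \<and> joined (orbit y) q (t q)}"
  have push: "joined (orbit y) (t a) (t b)" if "t \<in> T" "joined (orbit y) a b" for t a b
    using that(2) maps[OF that(1)] isometry[OF that(1)] orbit_invariant[OF that(1) _ y]
    by (rule joined_isometry)
  have S_comp: "\<exists>h\<in>S. \<forall>x\<in>M. h x = s (t x)" if "s \<in> S" "t \<in> S" for s t
  proof -
    have st: "s \<in> T" "joined (orbit y) p (s p)" "joined (orbit y) q (s q)"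
      "t \<in> T" "joined (orbit y) p (t p)" "joined (orbit y) q (t q)"
      using that by (simp_all add: S_def)
    obtain h where h: "h \<in> T" "\<forall>x\<in>M. h x = s (t x)"
      using composition[OF st(1,4)] by blast
    have "joined (orbit y) p (s (t p))" "joined (orbit y) q (s (t q))"
      using joined_trans[OF st(2) push[OF st(1,5)]] joined_trans[OF st(3) push[OF st(1,6)]]
      by auto
    then have "h \<in> S" using h p q by (simp add: S_def)
    with h show ?thesis by blast
  qed
  have S_inv: "\<exists>h\<in>S. \<forall>x\<in>M. h (t x) = x \<and> t (h x) = x" if t: "t \<in> S" for t
  proof -
    have "t \<in> T" using t by (simp add: S_def)
    then obtain h where h: "h \<in> T" "\<forall>x\<in>M. h (t x) = x \<and> t (h x) = x"
      using inverse by blast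
    have "joined (orbit y) p (t p)" "joined (orbit y) q (t q)"
      using t by (simp_all add: S_def)
    from joined_sym[OF push[OF h(1) this(1)]] joined_sym[OF push[OF h(1) this(2)]]
    have "joined (orbit y) p (h p)" "joined (orbit y) q (h q)"
      using h(2) p(1) q(1) by auto
    with h(1) have "h \<in> S" by (simp add: S_def)
    with h show ?thesis by blast
  qed
  obtain \<delta>p \<delta>q where dpq: "\<delta>p > 0" "\<forall>f\<in>T. \<delta>p \<le> d p (f y)" "\<delta>q > 0" "\<forall>f\<in>T. \<delta>q \<le> d q (f y)"
    using orbit_closed[OF p(1) y p(2)] orbit_closed[OF q(1) y q(2)] by blast
  define \<delta> where "\<delta> = min \<delta>p \<delta>q"
  have \<delta>: "\<delta> > 0" "\<And>f. f \<in> T \<Longrightarrow> \<delta> \<le> d p (f y)" "\<And>f. f \<in> T \<Longrightarrow> \<delta> \<le> d q (f y)"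
    using dpq by (auto simp: \<delta>_def min_le_iff_disj)
  have short: "joined (orbit y) a b"
    if ab: "a \<in> M" "b \<in> M" "d a b < \<delta>" and far: "\<And>f. f \<in> T \<Longrightarrow> \<delta> \<le> d a (f y)" for a b
  proof -
    obtain g where g: "geodesic g a b" using geodesic_exists ab by blast
    have "g s \<notin> orbit y" if s: "s \<in> {0..d a b}" for s
      using geodesic_dist(1)[OF g s] s ab(3) far by force
    then show ?thesis by (intro joined_geodesic[OF g]) blast
  qed
  have S_small: "\<exists>t\<in>S. \<forall>x\<in>M. d x (t x) = r" if r: "0 < r" "r < \<delta>" for r
  proof -
    obtain t where "t \<in> T" "\<forall>x\<in>M. d x (t x) = r" using displacement r by blast
    then show ?thesis using short[of p "t p"] short[of q "t q"] p q r \<delta> maps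
      unfolding S_def by auto
  qed
  \<comment> \<open>if no translate of \<open>g\<close> is a detour, then \<open>S\<close> moves \<open>y\<close> along \<open>g\<close>\<close>
  obtain g where g: "geodesic g p q" using geodesic_exists p q by blast
  have "\<exists>s\<in>{0..d p q}. g s = t y" if t: "t \<in> S" for t
  proof (rule ccontr)
    assume avoid: "\<not> ?thesis"
    obtain h where h: "h \<in> S" "\<forall>x\<in>M. t (h x) = x" using S_inv[OF t] by blast
    have hT: "h \<in> T" using h by (simp add: S_def)
    have "joined {t y} p q" using avoid by (intro joined_geodesic[OF g]) blast
    then have "joined {y} (h p) (h q)"
    proof (rule joined_isometry)
      show "x \<in> {t y}" if "x \<in> M" "h x \<in> {y}" for x using that h(2) by force
    qed (simp_all add: maps[OF hT] isometry[OF hT])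
    moreover have "joined {y} p (h p)" "joined {y} q (h q)"
      using h(1) orbit_self[OF y] joined_mono[of "orbit y" _ _ "{y}"] unfolding S_def by simp_all
    ultimately show False using contr joined_trans[of "{y}"] joined_sym[of "{y}"] by meson
  qed
  then have "\<forall>t\<in>S. \<exists>s. s \<in> {0..d p q} \<and> g s = t y" by blast
  from bchoice[OF this] obtain \<sigma> where
    "\<forall>t\<in>S. \<sigma> t \<in> {0..d p q} \<and> g (\<sigma> t) = t y" ..
  then have \<sigma>: "\<And>t. t \<in> S \<Longrightarrow> \<sigma> t \<in> {0..d p q}" "\<And>t. t \<in> S \<Longrightarrow> g (\<sigma> t) = t y"
    by blast+
  have \<sigma>_dist: "\<bar>\<sigma> s - \<sigma> t\<bar> = d (s y) (t y)" if "s \<in> S" "t \<in> S" for s t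
  proof -
    have "d (g (\<sigma> s)) (g (\<sigma> t)) = \<bar>\<sigma> s - \<sigma> t\<bar>"
      using g \<sigma>(1)[OF that(1)] \<sigma>(1)[OF that(2)] unfolding geodesic_def by blast
    then show ?thesis by (simp add: \<sigma>(2) that)
  qed
  have ST: "t \<in> T" if "t \<in> S" for t using that by (simp add: S_def)
  have "\<exists>u v. \<sigma> ` S \<subseteq> {u, v}"
  proof (rule homogeneous_bounded_real_set)
    show "\<sigma> ` S \<subseteq> {0..d p q}" using \<sigma>(1) by blast
    fix a b c assume "a \<in> \<sigma> ` S" "b \<in> \<sigma> ` S" "c \<in> \<sigma> ` S"
    then obtain r s t where rst: "r \<in> S" "s \<in> S" "t \<in> S" "a = \<sigma> r" "b = \<sigma> s" "c = \<sigma> t"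
      by blast
    \<comment> \<open>the element \<open>s r\<inverse> t\<close> of \<open>S\<close> stands to \<open>s\<close> as \<open>t\<close> stands to \<open>r\<close>\<close>
    obtain r' where r': "r' \<in> S" "\<forall>x\<in>M. r' (r x) = x" using S_inv[OF rst(1)] by blast
    obtain k where k: "k \<in> S" "\<forall>x\<in>M. k x = s (r' x)" using S_comp[OF rst(2) r'(1)] by blast
    obtain h where h: "h \<in> S" "\<forall>x\<in>M. h x = k (t x)" using S_comp[OF k(1) rst(3)] by blast
    have "d (s y) (h y) = d (k (r y)) (k (t y))"
      by (simp add: h(2) k(2) r'(2) y rst ST maps)
    also have "\<dots> = d (r y) (t y)" by (rule isometry) (simp_all add: k(1) rst ST maps y)
    finally have "\<bar>b - \<sigma> h\<bar> = \<bar>a - c\<bar>"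
      by (simp add: \<sigma>_dist rst h(1))
    then show "\<exists>q'\<in>\<sigma> ` S. \<bar>b - q'\<bar> = \<bar>a - c\<bar>" using h(1) by blast
  qed
  then obtain u v where uv: "\<sigma> ` S \<subseteq> {u, v}" by blast
  \<comment> \<open>the points \<open>y\<close>, \<open>t1 y\<close> and \<open>t2 y\<close> of the orbit have three different positions on \<open>g\<close>\<close>
  obtain t1 where t1: "t1 \<in> S" "\<forall>x\<in>M. d x (t1 x) = \<delta> / 2" using S_small[of "\<delta> / 2"] \<delta> by auto
  obtain t2 where t2: "t2 \<in> S" "\<forall>x\<in>M. d x (t2 x) = \<delta> / 3" using S_small[of "\<delta> / 3"] \<delta> by auto
  obtain t1' where t1': "t1' \<in> S" "\<forall>x\<in>M. t1' (t1 x) = x" using S_inv[OF t1(1)] by blast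
  obtain t0 where t0: "t0 \<in> S" "\<forall>x\<in>M. t0 x = t1' (t1 x)" using S_comp[OF t1'(1) t1(1)] by blast
  have "d (t0 y) (t1 y) = \<delta> / 2" "d (t0 y) (t2 y) = \<delta> / 3"
    using t0(2) t1'(2) t1(2) t2(2) y by simp_all
  then have "\<bar>\<sigma> t0 - \<sigma> t1\<bar> = \<delta> / 2" "\<bar>\<sigma> t0 - \<sigma> t2\<bar> = \<delta> / 3"
    by (simp_all add: \<sigma>_dist t0(1) t1(1) t2(1))
  moreover have "\<sigma> t0 \<in> {u, v}" "\<sigma> t1 \<in> {u, v}" "\<sigma> t2 \<in> {u, v}" using uv t0 t1 t2 by auto
  ultimately show False using \<delta>(1) by auto
qed

theorem no_global_cut_point: "\<not> has_global_cut_point mtopology"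
proof -
  have "path_connectedin mtopology (M - {y})" if y: "y \<in> M" for y
  proof -
    have "joined {y} p q" if pq: "p \<in> M - {y}" "q \<in> M - {y}" for p q
    proof -
      obtain p' q' where "p' \<in> M" "p' \<notin> orbit y" "joined {y} p p'"
        "q' \<in> M" "q' \<notin> orbit y" "joined {y} q q'"
        using escape_orbit[OF _ _ y, of p] escape_orbit[OF _ _ y, of q] pq by blast
      then show ?thesis
        using joined_off_orbit[OF y] joined_trans[of "{y}"] joined_sym[of "{y}"] by meson
    qed
    then show ?thesis
      unfolding path_connectedin_def path_connected_space_iff_path_component joined_def by auto
  qed
  moreover have "M \<noteq> {y}" for y
    using transversal[of y] by auto
  ultimately show ?thesis by (auto simp: has_global_cut_point_def)
qed

end


section \<open>Cones of discretely geodesic spaces\<close>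

lemma bounded_error_over_scale_tendsto:
  fixes d :: "'i \<Rightarrow> real"
  assumes d: "filterlim d at_top F" and pos: "\<And>i. 0 < d i" and s: "0 \<le> s"
    and f: "\<And>i. \<bar>f i - s * d i\<bar> \<le> c"
  shows "((\<lambda>i. f i / d i) \<longlongrightarrow> s) F"
proof -
  have scale: "((\<lambda>i. c / d i) \<longlongrightarrow> 0) F"
    using d by (intro real_tendsto_divide_at_top[OF tendsto_const]) 
  have bound: "norm (f i / d i - s) \<le> c / d i" for i
  proof -
    have "f i / d i - s = (f i - s * d i) / d i" using pos[of i] by (simp add: field_simps)
    then show ?thesis using f[of i] pos[of i] by (simp add: divide_right_mono)
  qed
  have "((\<lambda>i. f i / d i - s) \<longlongrightarrow> 0) F"
    by (rule Lim_null_comparison[OF always_eventually[OF allI[OF bound]] scale])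
  then show ?thesis by (simp add: LIM_zero_iff)
qed

context
  fixes M :: "'a set" and dst :: "'a \<Rightarrow> 'a \<Rightarrow> real"
    and \<omega> :: "'i filter" and e :: "'i \<Rightarrow> 'a" and d :: "'i \<Rightarrow> real"
  assumes M: "Metric_space M dst" and ultra: "ultrafilter \<omega>"
    and e: "\<And>i. e i \<in> M" and d: "\<And>i. 0 < d i"
begin

interpretation Metric_space M dst by (rule M)

interpretation cone: Metric_space "asymptotic_cone M dst \<omega> e d" "cone_dist M dst \<omega> e d"
  by (rule Metric_space_cone[OF M ultra e d])

lemma cone_pdist_eqI:
  "((\<lambda>i. dst (x i) (y i) / d i) \<longlongrightarrow> L) \<omega> \<Longrightarrow> cone_pdist dst \<omega> d x y = L"
  using ultra by (simp add: cone_pdist_def ultrafilter_def tendsto_Lim)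

text \<open>A sequence whose distance from \<open>x\<close> is of the order of \<open>d\<close> represents a point of the cone: its
  rescaled distances from the base point are bounded, and so converge along the ultrafilter.\<close>

lemma cone_sequences_near:
  assumes x: "x \<in> cone_sequences M dst \<omega> e d" and w: "\<And>i. w i \<in> M"
    and near: "((\<lambda>i. b i / d i) \<longlongrightarrow> B) \<omega>" "\<And>i. dst (x i) (w i) \<le> b i"
  shows "w \<in> cone_sequences M dst \<omega> e d"
proof -
  obtain L where L: "((\<lambda>i. dst (x i) (e i) / d i) \<longlongrightarrow> L) \<omega>" and xM: "\<And>i. x i \<in> M"
    using x by (auto simp: cone_sequences_def)
  have "eventually (\<lambda>i. dst (x i) (e i) / d i + b i / d i < L + B + 1) \<omega>"
    by (rule order_tendstoD(2)[OF tendsto_add[OF L near(1)]]) simp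
  then have "eventually (\<lambda>i. 0 \<le> dst (w i) (e i) / d i \<and> dst (w i) (e i) / d i \<le> L + B + 1) \<omega>"
  proof eventually_elim
    case (elim i)
    have "dst (w i) (e i) \<le> dst (x i) (e i) + b i"
      using triangle[OF w[of i] xM[of i] e[of i]] commute[of "w i" "x i"] near(2)[of i] by linarith
    then have "dst (w i) (e i) / d i \<le> (dst (x i) (e i) + b i) / d i"
      using d[of i] by (simp add: divide_right_mono)
    with elim d[of i] show ?case by (simp add: add_divide_distrib less_imp_le)
  qed
  from ultrafilter_bounded_limit[OF ultra this] w show ?thesis
    by (auto simp: cone_sequences_def)
qed

lemma cone_pdist_mono:
  assumes "u \<in> cone_sequences M dst \<omega> e d" "v \<in> cone_sequences M dst \<omega> e d"
    and "x \<in> cone_sequences M dst \<omega> e d" "y \<in> cone_sequences M dst \<omega> e d"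
    and le: "\<And>i. dst (u i) (v i) \<le> dst (x i) (y i)"
  shows "cone_pdist dst \<omega> d u v \<le> cone_pdist dst \<omega> d x y"
proof (rule tendsto_le)
  show "\<omega> \<noteq> bot" using ultra by (simp add: ultrafilter_def)
  show "\<forall>\<^sub>F i in \<omega>. dst (u i) (v i) / d i \<le> dst (x i) (y i) / d i"
    using le d by (simp add: divide_right_mono less_imp_le)
qed (fact cone_pdist_tendsto[OF M ultra e d assms(1,2)]
      cone_pdist_tendsto[OF M ultra e d assms(3,4)])+

lemma cone_cases:
  assumes "X \<in> asymptotic_cone M dst \<omega> e d"
  obtains x where "x \<in> cone_sequences M dst \<omega> e d" "X = cone_rel M dst \<omega> e d `` {x}"
  using assms unfolding asymptotic_cone_def by (rule quotientE)

lemma cone_classI: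
  "x \<in> cone_sequences M dst \<omega> e d \<Longrightarrow> cone_rel M dst \<omega> e d `` {x} \<in> asymptotic_cone M dst \<omega> e d"
  by (simp add: asymptotic_cone_def quotientI)

lemma cone_class_eq_iff:
  assumes "x \<in> cone_sequences M dst \<omega> e d" "y \<in> cone_sequences M dst \<omega> e d"
  shows "cone_rel M dst \<omega> e d `` {x} = cone_rel M dst \<omega> e d `` {y} \<longleftrightarrow> cone_pdist dst \<omega> d x y = 0"
  using assms eq_equiv_class_iff[OF equiv_cone_rel[OF M ultra e d] assms]
  by (simp add: cone_rel_def)

text \<open>Let \<open>P i\<close> be a discrete geodesic of length \<open>N i\<close> from \<open>x i\<close> to \<open>y i\<close>. The sequence of its points
  at time about \<open>s d i\<close> represents the point at distance \<open>s\<close> on the geodesic in the cone, since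
  rounding to an integer is invisible after division by \<open>d\<close>.\<close>

lemma cone_geodesic_exists:
  assumes large: "filterlim d at_top \<omega>"
    and discrete: "\<And>x y. x \<in> M \<Longrightarrow> y \<in> M \<Longrightarrow> \<exists>p n. p 0 = x \<and> p n = y \<and> p ` {..n} \<subseteq> M \<and>
      (\<forall>i\<le>n. \<forall>j\<le>n. dst (p i) (p j) = \<bar>real i - real j\<bar>)"
    and X: "X \<in> asymptotic_cone M dst \<omega> e d" and Y: "Y \<in> asymptotic_cone M dst \<omega> e d"
  shows "\<exists>g. cone.geodesic g X Y"
proof -
  let ?S = "cone_sequences M dst \<omega> e d" and ?R = "cone_rel M dst \<omega> e d"
  obtain x where x: "x \<in> ?S" "X = ?R `` {x}" using X by (rule cone_cases)
  obtain y where y: "y \<in> ?S" "Y = ?R `` {y}" using Y by (rule cone_cases)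
  define \<Delta> where "\<Delta> = cone_pdist dst \<omega> d x y"
  have \<Delta>: "cone_dist M dst \<omega> e d X Y = \<Delta>" "0 \<le> \<Delta>"
    using x y cone_pdist_props(1)[OF M ultra e d x(1) y(1)]
    by (simp_all add: \<Delta>_def cone_dist_class[OF M ultra e d])
  have "\<forall>i. \<exists>p n. p 0 = x i \<and> p n = y i \<and> p ` {..n} \<subseteq> M \<and>
      (\<forall>j\<le>n. \<forall>k\<le>n. dst (p j) (p k) = \<bar>real j - real k\<bar>)"
    using x(1) y(1) discrete by (simp add: cone_sequences_def)
  then obtain P N where P: "\<And>i. P i 0 = x i" "\<And>i. P i (N i) = y i" "\<And>i. P i ` {..N i} \<subseteq> M"
    "\<And>i j k. j \<le> N i \<Longrightarrow> k \<le> N i \<Longrightarrow> dst (P i j) (P i k) = \<bar>real j - real k\<bar>"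
    by metis
  \<comment> \<open>\<open>N i\<close> may be smaller than \<open>s * d i\<close> even for \<open>s \<le> \<Delta>\<close>, where \<open>\<Delta>\<close> is only the limit of \<open>N i / d i\<close>\<close>
  define c where "c s i = min (N i) (nat \<lfloor>s * d i\<rfloor>)" for s i
  define w where "w s i = P i (c s i)" for s i
  have N: "dst (x i) (y i) = real (N i)" for i
    using P(4)[of 0 i "N i"] P(1,2)[of i] by simp
  have N_lim: "((\<lambda>i. real (N i) / d i) \<longlongrightarrow> \<Delta>) \<omega>"
    using cone_pdist_tendsto[OF M ultra e d x(1) y(1)] by (simp add: N \<Delta>_def)
  have c_lim: "((\<lambda>i. real (c s i) / d i) \<longlongrightarrow> min \<Delta> s) \<omega>" if "0 \<le> s" for s
  proof -
    have "\<bar>real (nat \<lfloor>s * d i\<rfloor>) - s * d i\<bar> \<le> 1" for i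
      using that d[of i] by (simp add: less_imp_le) linarith
    then have "((\<lambda>i. real (nat \<lfloor>s * d i\<rfloor>) / d i) \<longlongrightarrow> s) \<omega>"
      by (rule bounded_error_over_scale_tendsto[OF large d that])
    moreover have "real (c s i) / d i = min (real (N i) / d i) (real (nat \<lfloor>s * d i\<rfloor>) / d i)" for i
      using d[of i] by (simp add: c_def of_nat_min min_divide_distrib_right)
    ultimately show ?thesis using tendsto_min[OF N_lim] by simp
  qed
  have w_dst: "dst (w s i) (w t i) = \<bar>real (c s i) - real (c t i)\<bar>" for s t i
    unfolding w_def by (rule P(4)) (simp_all add: c_def)
  have x_w: "dst (x i) (w s i) = real (c s i)" for s i
    unfolding w_def using P(4)[of 0 i "c s i"] P(1)[of i] by (simp add: c_def)
  have w_seq: "w s \<in> ?S" if "0 \<le> s" for s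
  proof (rule cone_sequences_near[OF x(1) _ c_lim[OF that]])
    show "w s i \<in> M" for i using P(3)[of i] by (auto simp: w_def c_def image_subset_iff)
    show "dst (x i) (w s i) \<le> real (c s i)" for i by (simp add: x_w)
  qed
  have w_pdist: "cone_pdist dst \<omega> d (w s) (w t) = \<bar>min \<Delta> s - min \<Delta> t\<bar>" if "0 \<le> s" "0 \<le> t" for s t
  proof (rule cone_pdist_eqI)
    have "dst (w s i) (w t i) / d i = \<bar>real (c s i) / d i - real (c t i) / d i\<bar>" for i
      using d[of i] by (simp add: w_dst flip: diff_divide_distrib)
    then show "((\<lambda>i. dst (w s i) (w t i) / d i) \<longlongrightarrow> \<bar>min \<Delta> s - min \<Delta> t\<bar>) \<omega>"
      using tendsto_rabs[OF tendsto_diff[OF c_lim c_lim]] that by simp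
  qed
  have w0: "w 0 = x" by (simp add: w_def c_def fun_eq_iff P(1))
  have w\<Delta>: "cone_pdist dst \<omega> d (w \<Delta>) y = 0"
  proof (rule cone_pdist_eqI)
    have "dst (w \<Delta> i) (y i) / d i = real (N i) / d i - real (c \<Delta> i) / d i" for i
      using P(4)[of "c \<Delta> i" i "N i"] P(2)[of i] by (simp add: w_def c_def diff_divide_distrib)
    then show "((\<lambda>i. dst (w \<Delta> i) (y i) / d i) \<longlongrightarrow> 0) \<omega>"
      using tendsto_diff[OF N_lim c_lim[OF \<Delta>(2)]] by simp
  qed
  have "cone.geodesic (\<lambda>s. ?R `` {w s}) X Y"
    unfolding cone.geodesic_def \<Delta>(1)
  proof (intro conjI ballI)
    show "?R `` {w 0} = X" by (simp add: w0 x)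
    show "?R `` {w \<Delta>} = Y" using w\<Delta> \<Delta>(2) by (simp add: y cone_class_eq_iff w_seq)
    show "(\<lambda>s. ?R `` {w s}) ` {0..\<Delta>} \<subseteq> asymptotic_cone M dst \<omega> e d"
      using w_seq by (auto intro: cone_classI)
    show "cone_dist M dst \<omega> e d (?R `` {w s}) (?R `` {w t}) = \<bar>s - t\<bar>"
      if "s \<in> {0..\<Delta>}" "t \<in> {0..\<Delta>}" for s t
      using that by (simp add: cone_dist_class[OF M ultra e d] w_seq w_pdist)
  qed
  then show ?thesis by blast
qed

end


section \<open>Word metrics\<close>

context
  fixes G :: "('g, 'b) monoid_scheme" and S :: "'g set"
  assumes G: "group G" and S: "generates G S"
begin

interpretation group G by (rule G)

interpretation W: Metric_space "carrier G" "word_dist G S"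
  by (rule Metric_space_word_dist[OF G S])

lemma word_dist_translate:
  assumes "a \<in> carrier G" "b \<in> carrier G" "c \<in> carrier G"
  shows "word_dist G S (a \<otimes>\<^bsub>G\<^esub> b) (a \<otimes>\<^bsub>G\<^esub> c) = word_dist G S b c"
proof -
  have "inv\<^bsub>G\<^esub> (a \<otimes>\<^bsub>G\<^esub> b) \<otimes>\<^bsub>G\<^esub> (a \<otimes>\<^bsub>G\<^esub> c) = inv\<^bsub>G\<^esub> b \<otimes>\<^bsub>G\<^esub> c"
    using assms by (simp add: inv_mult_group m_assoc) (simp add: inv_solve_left' flip: m_assoc)
  then show ?thesis using assms by (simp add: word_dist_def)
qed

lemma word_dist_mult_right:
  assumes "a \<in> carrier G" "b \<in> carrier G"
  shows "word_dist G S a (a \<otimes>\<^bsub>G\<^esub> b) = word_length G S b"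
  using word_dist_translate[of a "\<one>\<^bsub>G\<^esub>" b] assms by (simp add: word_dist_def)

lemma word_dist_one:
  assumes "g \<in> carrier G"
  shows "word_dist G S \<one>\<^bsub>G\<^esub> g = word_length G S g" "word_dist G S g \<one>\<^bsub>G\<^esub> = word_length G S g"
  using word_dist_mult_right[of "\<one>\<^bsub>G\<^esub>" g] assms by (simp_all add: W.commute)

text \<open>The prefixes of a shortest word for \<open>x\<inverse> y\<close>, multiplied by \<open>x\<close>, advance by steps of length at
  most 1; as the word is shortest, no two of them are closer than the number of steps between them.\<close>

lemma word_geodesic_exists:
  assumes x: "x \<in> carrier G" and y: "y \<in> carrier G"
  shows "\<exists>p n. p 0 = x \<and> p n = y \<and> p ` {..n} \<subseteq> carrier G \<and>
    (\<forall>i\<le>n. \<forall>j\<le>n. word_dist G S (p i) (p j) = \<bar>real i - real j\<bar>)"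
proof -
  let ?W = "\<lambda>us. foldr (\<otimes>\<^bsub>G\<^esub>) us \<one>\<^bsub>G\<^esub>"
  have mem: "inv\<^bsub>G\<^esub> x \<otimes>\<^bsub>G\<^esub> y \<in> carrier G" using x y by simp
  obtain ws where ws: "length ws = word_length G S (inv\<^bsub>G\<^esub> x \<otimes>\<^bsub>G\<^esub> y)"
      "set ws \<subseteq> S \<union> m_inv G ` S" "?W ws = inv\<^bsub>G\<^esub> x \<otimes>\<^bsub>G\<^esub> y"
    using word_length_attained[OF G S mem] by blast
  define n where "n = length ws"
  define p where "p i = x \<otimes>\<^bsub>G\<^esub> ?W (take i ws)" for i
  have sub: "set (take i ws) \<subseteq> S \<union> m_inv G ` S" "set (take j (drop i ws)) \<subseteq> S \<union> m_inv G ` S"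
    for i j using ws(2) set_take_subset set_drop_subset by fast+
  have W_mem: "?W (take i ws) \<in> carrier G" "?W (take j (drop i ws)) \<in> carrier G" for i j
    using word_closed[OF G S] sub by blast+
  have p_mem: "p i \<in> carrier G" for i using x W_mem by (simp add: p_def)
  have p0: "p 0 = x" using x by (simp add: p_def)
  have pn: "p n = y" using x y ws(3) by (simp add: p_def n_def flip: m_assoc)
  have upper: "word_dist G S (p i) (p j) \<le> real j - real i" if "i \<le> j" "j \<le> n" for i j
  proof -
    have "take j ws = take i ws @ take (j - i) (drop i ws)"
      using that(1) take_add[of i "j - i" ws] by simp
    then have "?W (take j ws) = ?W (take i ws) \<otimes>\<^bsub>G\<^esub> ?W (take (j - i) (drop i ws))"
      using word_append[OF G S sub] by simp
    then have "p j = p i \<otimes>\<^bsub>G\<^esub> ?W (take (j - i) (drop i ws))"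
      using x W_mem by (simp add: p_def m_assoc)
    then have "word_dist G S (p i) (p j) = word_length G S (?W (take (j - i) (drop i ws)))"
      using word_dist_mult_right p_mem W_mem by simp
    also have "\<dots> \<le> length (take (j - i) (drop i ws))"
      using word_length_le[OF G S sub(2) refl] by simp
    finally show ?thesis using that by (simp add: n_def)
  qed
  have total: "word_dist G S (p 0) (p n) = real n"
    unfolding p0 pn using x y ws(1) by (simp add: word_dist_def n_def)
  have dist: "word_dist G S (p i) (p j) = real j - real i" if "i \<le> j" "j \<le> n" for i j
  proof -
    have "word_dist G S (p 0) (p i) \<le> real i" "word_dist G S (p j) (p n) \<le> real n - real j"
      using upper[of 0 i] upper[of j n] that by simp_all
    then show ?thesis
      using upper[OF that] total W.triangle[OF p_mem[of 0] p_mem[of i] p_mem[of n]]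
        W.triangle[OF p_mem[of i] p_mem[of j] p_mem[of n]] by linarith
  qed
  have "word_dist G S (p i) (p j) = \<bar>real i - real j\<bar>" if "i \<le> n" "j \<le> n" for i j
    using dist[of i j] dist[of j i] that by (cases "i \<le> j") (simp_all add: W.commute)
  then show ?thesis using p0 pn p_mem by (intro exI[of _ p] exI[of _ n]) auto
qed

lemma finite_word_ball:
  assumes "finite S"
  shows "finite {g \<in> carrier G. word_length G S g \<le> n}"
proof (rule finite_subset)
  let ?A = "S \<union> m_inv G ` S"
  show "{g \<in> carrier G. word_length G S g \<le> n} \<subseteq>
      (\<lambda>ws. foldr (\<otimes>\<^bsub>G\<^esub>) ws \<one>\<^bsub>G\<^esub>) ` {ws. set ws \<subseteq> ?A \<and> length ws \<le> n}"
  proof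
    fix g assume g: "g \<in> {g \<in> carrier G. word_length G S g \<le> n}"
    then obtain ws where "length ws = word_length G S g" "set ws \<subseteq> ?A"
        "foldr (\<otimes>\<^bsub>G\<^esub>) ws \<one>\<^bsub>G\<^esub> = g"
      using word_length_attained[OF G S, of g] by blast
    with g show "g \<in> (\<lambda>ws. foldr (\<otimes>\<^bsub>G\<^esub>) ws \<one>\<^bsub>G\<^esub>) ` {ws. set ws \<subseteq> ?A \<and> length ws \<le> n}"
      by (intro image_eqI[of _ _ ws]) auto
  qed
  show "finite ((\<lambda>ws. foldr (\<otimes>\<^bsub>G\<^esub>) ws \<one>\<^bsub>G\<^esub>) ` {ws. set ws \<subseteq> ?A \<and> length ws \<le> n})"
    using assms by (intro finite_imageI finite_lists_length_le) simp
qed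

text \<open>The lengths of the powers \<open>z\<^sup>0, z\<^sup>1, z\<^sup>2, \<dots>\<close> of a generator of \<open>H\<close> are unbounded, because
  balls are finite, and they increase by at most \<open>c\<close>, the length of \<open>z\<close>, in each step. The first
  power of length at least \<open>r\<close> therefore has length at most \<open>r + c\<close>.\<close>

lemma infinite_cyclic_subgroup_lengths:
  assumes fin: "finite S" and H: "subgroup H G" "cyclic_group (G\<lparr>carrier := H\<rparr>)" "infinite H"
  shows "\<exists>c. \<forall>r\<ge>0. \<exists>h\<in>H. r \<le> real (word_length G S h) \<and> real (word_length G S h) \<le> r + c"
proof -
  interpret H: group "G\<lparr>carrier := H\<rparr>" using H(1) by (rule subgroup_imp_group)
  obtain z where z: "z \<in> H" "H = range (\<lambda>k::int. z [^]\<^bsub>G\<lparr>carrier := H\<rparr>\<^esub> k)"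
    using H(2) H.cyclic_group by auto
  have zG: "z \<in> carrier G" using z(1) H(1) by (rule subgroup.mem_carrier[rotated])
  let ?l = "\<lambda>n::nat. word_length G S (z [^]\<^bsub>G\<^esub> n)"
  have pow: "z [^]\<^bsub>G\<lparr>carrier := H\<rparr>\<^esub> k = z [^]\<^bsub>G\<^esub> k" for k :: int
    using int_pow_consistent[OF H(1) z(1)] by simp
  have inH: "z [^]\<^bsub>G\<^esub> n \<in> H" for n :: nat
    using z(2) pow[of "int n"] by (metis int_pow_int rangeI)
  have "\<exists>n. r \<le> real (?l n)" for r :: real
  proof -
    have "\<not> H \<subseteq> {g \<in> carrier G. word_length G S g \<le> nat \<lceil>r\<rceil>}"
      using H(3) finite_word_ball[OF fin] finite_subset by blast
    then obtain h where h: "h \<in> H" "\<not> word_length G S h \<le> nat \<lceil>r\<rceil>"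
      using subgroup.subset[OF H(1)] by blast
    then obtain k :: int where k: "h = z [^]\<^bsub>G\<^esub> k" using z(2) pow by auto
    have hG: "h \<in> carrier G" using h subgroup.subset[OF H(1)] by blast
    have "?l (nat \<bar>k\<bar>) \<ge> word_length G S h"
    proof (cases "0 \<le> k")
      case True
      then show ?thesis using k int_pow_int[of G z "nat k"] by simp
    next
      case False
      then have "inv\<^bsub>G\<^esub> (z [^]\<^bsub>G\<^esub> nat \<bar>k\<bar>) = h"
        using k zG int_pow_int[of G z "nat \<bar>k\<bar>"] int_pow_neg[OF zG, of "- k"] by simp
      then show ?thesis using word_length_inv_le[OF G S, of "z [^]\<^bsub>G\<^esub> nat \<bar>k\<bar>"] zG by simp
    qed
    then have "r \<le> real (?l (nat \<bar>k\<bar>))" using h(2) by linarith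
    then show ?thesis ..
  qed
  moreover have "real (?l (Suc n)) \<le> real (?l n) + real (word_length G S z)" for n
    using word_length_mult_le[OF G S, of "z [^]\<^bsub>G\<^esub> n" z] zG by simp
  moreover have "?l 0 = 0" using word_length_eq_0[OF G S, of "\<one>\<^bsub>G\<^esub>"] by simp
  ultimately have "\<exists>n. r \<le> real (?l n) \<and> real (?l n) \<le> r + real (word_length G S z)"
    if "0 \<le> r" for r :: real
  proof -
    define n where "n = (LEAST n. r \<le> real (?l n))"
    assume unb: "\<And>r. \<exists>n. r \<le> real (?l n)"
      and step: "\<And>n. real (?l (Suc n)) \<le> real (?l n) + real (word_length G S z)"
      and zero: "?l 0 = 0"
    have n: "r \<le> real (?l n)" unfolding n_def using unb[of r] by (rule LeastI_ex)
    have "real (?l n) \<le> r + real (word_length G S z)"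
    proof (cases n)
      case 0
      then show ?thesis using zero \<open>0 \<le> r\<close> by simp
    next
      case (Suc m)
      then have "\<not> r \<le> real (?l m)" unfolding n_def by (intro not_less_Least) simp
      then show ?thesis using step[of m] Suc by simp
    qed
    with n show ?thesis by blast
  qed
  then show ?thesis using inH by blast
qed

text \<open>Some coset \<open>H a\<close> misses the ball of radius \<open>m\<close>, since otherwise there would be finitely many
  cosets. Let \<open>b\<close> be a shortest element of this coset. Its length \<open>n > m\<close> is also its distance from
  \<open>H\<close>: the distance of \<open>b\<close> from \<open>h\<close> is the length of \<open>h\<inverse> b\<close>, another element of the
  coset. On a geodesic from \<open>\<one>\<close> to \<open>b\<close>, the point at distance \<open>m\<close> from \<open>\<one>\<close> is
  at distance \<open>n - m\<close> from \<open>b\<close>, and hence at distance at least \<open>m\<close> from \<open>H\<close>. The choice of a point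
  on the geodesic makes the length exactly \<open>m\<close>.\<close>

lemma infinite_index_far_elements:
  assumes fin: "finite S" and H: "subgroup H G" "infinite (rcosets\<^bsub>G\<^esub> H)"
  shows "\<exists>g\<in>carrier G. word_length G S g = m \<and> (\<forall>h\<in>H. real m \<le> word_dist G S g h)"
proof -
  have HG: "H \<subseteq> carrier G" using H(1) by (rule subgroup.subset)
  let ?B = "{g \<in> carrier G. word_length G S g \<le> m}"
  have "\<not> (rcosets\<^bsub>G\<^esub> H) \<subseteq> (\<lambda>b. H #>\<^bsub>G\<^esub> b) ` ?B"
    using H(2) finite_word_ball[OF fin] by (meson finite_imageI finite_subset)
  then obtain a where a: "a \<in> carrier G" "H #>\<^bsub>G\<^esub> a \<notin> (\<lambda>b. H #>\<^bsub>G\<^esub> b) ` ?B"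
    by (auto simp: RCOSETS_def)
  have far: "m < word_length G S (h \<otimes>\<^bsub>G\<^esub> a)" if "h \<in> H" for h
  proof (rule ccontr)
    assume "\<not> ?thesis"
    then have "h \<otimes>\<^bsub>G\<^esub> a \<in> ?B" using that HG a by auto
    moreover have "H #>\<^bsub>G\<^esub> (h \<otimes>\<^bsub>G\<^esub> a) = H #>\<^bsub>G\<^esub> a"
      using that HG a H(1) coset_mult_assoc[OF HG, of h a] coset_join2[OF _ H(1), of h] by auto
    ultimately have "H #>\<^bsub>G\<^esub> a \<in> (\<lambda>b. H #>\<^bsub>G\<^esub> b) ` ?B"
      by (intro image_eqI[of _ _ "h \<otimes>\<^bsub>G\<^esub> a"]) (rule sym)
    with a(2) show False ..
  qed
  define n where "n = (LEAST n. \<exists>h\<in>H. word_length G S (h \<otimes>\<^bsub>G\<^esub> a) = n)"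
  have "\<exists>n. \<exists>h\<in>H. word_length G S (h \<otimes>\<^bsub>G\<^esub> a) = n"
    using subgroup.one_closed[OF H(1)] by blast
  from LeastI_ex[OF this] obtain h0 where h0: "h0 \<in> H" "word_length G S (h0 \<otimes>\<^bsub>G\<^esub> a) = n"
    unfolding n_def by blast
  have least: "n \<le> word_length G S (h \<otimes>\<^bsub>G\<^esub> a)" if "h \<in> H" for h
    unfolding n_def using that by (intro Least_le) blast
  define b where "b = h0 \<otimes>\<^bsub>G\<^esub> a"
  have b: "b \<in> carrier G" using h0 HG a by (auto simp: b_def)
  have b_far: "real n \<le> word_dist G S b h" if h: "h \<in> H" for h
  proof -
    have hG: "h \<in> carrier G" "h0 \<in> carrier G" using h h0 HG by auto
    have "inv\<^bsub>G\<^esub> h \<otimes>\<^bsub>G\<^esub> h0 \<in> H" using H(1) h h0 by (simp add: subgroup_def)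
    from least[OF this] have "n \<le> word_length G S (inv\<^bsub>G\<^esub> h \<otimes>\<^bsub>G\<^esub> b)"
      using hG a by (simp add: b_def m_assoc)
    also have "\<dots> = word_dist G S h b" using hG b by (simp add: word_dist_def)
    finally show ?thesis by (simp add: W.commute)
  qed
  obtain p N where p: "p 0 = \<one>\<^bsub>G\<^esub>" "p N = b" "p ` {..N} \<subseteq> carrier G"
    "\<forall>i\<le>N. \<forall>j\<le>N. word_dist G S (p i) (p j) = \<bar>real i - real j\<bar>"
    using word_geodesic_exists[OF one_closed b] by blast
  have "word_dist G S \<one>\<^bsub>G\<^esub> b = real n" using h0 b by (simp add: word_dist_one b_def)
  moreover have "word_dist G S (p 0) (p N) = real N" using p(4) by simp
  ultimately have N: "N = n" using p(1,2) by simp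
  have mn: "m < n" using far h0 by auto
  have pm: "p m \<in> carrier G" using p(3) mn N by auto
  show ?thesis
  proof (intro bexI[OF _ pm] conjI ballI)
    have "word_dist G S (p 0) (p m) = real m" using p(4) mn N by simp
    then show "word_length G S (p m) = m" using p(1) pm by (simp add: word_dist_one)
    fix h assume h: "h \<in> H"
    have "word_dist G S b (p m) = real n - real m" 
    proof -
      have "word_dist G S (p N) (p m) = \<bar>real N - real m\<bar>" using p(4) mn N by simp
      then show ?thesis using p(2) mn N by simp
    qed
    then show "real m \<le> word_dist G S (p m) h"
      using b_far[OF h] W.triangle[OF b pm, of h] h HG by auto
  qed
qed

end


section \<open>Translations of the cone by a central subgroup\<close>

text \<open>What the cone has to know about \<open>G\<close> and \<open>H\<close>: the lengths of elements of \<open>H\<close> fill the half-line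
  up to a bounded error, and there are elements of every length to which no point of
  \<open>H\<close> is closer than \<open>\<one>\<close>. The first gives small translations of the cone, the second directions
  transversal to their orbits.\<close>

locale central_subgroup_cone = group G for G :: "('g, 'b) monoid_scheme" (structure) +
  fixes S H :: "'g set" and \<omega> :: "'i filter" and d :: "'i \<Rightarrow> real" and c :: real
  assumes S: "generates G S"
    and H: "subgroup H G"
    and central: "h \<in> H \<Longrightarrow> g \<in> carrier G \<Longrightarrow> h \<otimes> g = g \<otimes> h"
    and ultra: "ultrafilter \<omega>"
    and d: "0 < d i"
    and d_at_top: "filterlim d at_top \<omega>"
    and lengths: "0 \<le> r \<Longrightarrow> \<exists>h\<in>H. r \<le> real (word_length G S h) \<and> real (word_length G S h) \<le> r + c"
    and far: "\<exists>g\<in>carrier G. word_length G S g = m \<and> (\<forall>h\<in>H. real m \<le> word_dist G S g h)"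
begin

abbreviation "dst \<equiv> word_dist G S"
abbreviation "seqs \<equiv> cone_sequences (carrier G) dst \<omega> (\<lambda>_. \<one>) d"
abbreviation "cls x \<equiv> cone_rel (carrier G) dst \<omega> (\<lambda>_. \<one>) d `` {x}"
abbreviation "Con \<equiv> asymptotic_cone (carrier G) dst \<omega> (\<lambda>_. \<one>) d"
abbreviation "cdist \<equiv> cone_dist (carrier G) dst \<omega> (\<lambda>_. \<one>) d"
abbreviation "pdist \<equiv> cone_pdist dst \<omega> d"
abbreviation "H_seqs \<equiv> {h \<in> seqs. \<forall>i. h i \<in> H}"

lemmas cone_facts = Metric_space_word_dist[OF is_group S] ultra one_closed d
lemmas pdist_eqI = cone_pdist_eqI[OF cone_facts]
lemmas cdist_cls = cone_dist_class[OF cone_facts]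

interpretation W: Metric_space "carrier G" dst
  by (rule Metric_space_word_dist[OF is_group S])

interpretation Con: Metric_space Con cdist
  by (rule Metric_space_cone[OF cone_facts])

lemma H_carrier: "h \<in> H \<Longrightarrow> h \<in> carrier G"
  using subgroup.subset[OF H] by blast

lemma seqs_carrier: "x \<in> seqs \<Longrightarrow> x i \<in> carrier G"
  by (simp add: cone_sequences_def)

lemma const_one_seqs: "(\<lambda>_. \<one>) \<in> seqs"
  by (auto simp: cone_sequences_def)

lemma seqs_mult:
  assumes x: "x \<in> seqs" and g: "g \<in> seqs"
  shows "(\<lambda>i. x i \<otimes> g i) \<in> seqs"
proof (rule cone_sequences_near[OF cone_facts x])
  show "x i \<otimes> g i \<in> carrier G" for i using x g by (simp add: seqs_carrier)
  show "((\<lambda>i. dst (g i) \<one> / d i) \<longlongrightarrow> pdist g (\<lambda>_. \<one>)) \<omega>"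
    by (rule cone_pdist_tendsto[OF cone_facts g const_one_seqs])
  show "dst (x i) (x i \<otimes> g i) \<le> dst (g i) \<one>" for i
    using x g by (simp add: seqs_carrier word_dist_mult_right[OF is_group S] word_dist_one[OF is_group S])
qed

lemma seqs_of_length:
  assumes g: "\<And>i. g i \<in> carrier G" and len: "\<And>i. \<bar>real (word_length G S (g i)) - r * d i\<bar> \<le> b"
    and r: "0 \<le> r"
  shows "g \<in> seqs" "((\<lambda>i. real (word_length G S (g i)) / d i) \<longlongrightarrow> r) \<omega>"
proof -
  show lim: "((\<lambda>i. real (word_length G S (g i)) / d i) \<longlongrightarrow> r) \<omega>"
    by (rule bounded_error_over_scale_tendsto[OF d_at_top d r len])
  then show "g \<in> seqs"
    using g by (auto simp: cone_sequences_def word_dist_one[OF is_group S])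
qed

lemma pdist_mult_right:
  assumes x: "x \<in> seqs" and g: "\<And>i. g i \<in> carrier G"
    and lim: "((\<lambda>i. real (word_length G S (g i)) / d i) \<longlongrightarrow> r) \<omega>"
  shows "pdist x (\<lambda>i. x i \<otimes> g i) = r"
  by (rule pdist_eqI) (use x g lim in \<open>simp add: seqs_carrier word_dist_mult_right[OF is_group S]\<close>)

text \<open>The word metric is left-invariant; as \<open>h\<close> is central, multiplication by \<open>h\<close> on the right is
  multiplication on the left.\<close>

lemma dst_mult_central:
  assumes "h \<in> H" "a \<in> carrier G" "b \<in> carrier G"
  shows "dst (a \<otimes> h) (b \<otimes> h) = dst a b"
proof -
  have "a \<otimes> h = h \<otimes> a" "b \<otimes> h = h \<otimes> b" using assms central by metis+
  then show ?thesis
    using word_dist_translate[OF is_group S H_carrier[OF assms(1)] assms(2,3)] by simp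
qed

lemma H_seqs_mult:
  assumes "g \<in> H_seqs" "h \<in> H_seqs"
  shows "(\<lambda>i. g i \<otimes> h i) \<in> H_seqs"
  using assms by (simp add: seqs_mult subgroup.m_closed[OF H])

lemma H_seqs_inv:
  assumes h: "h \<in> H_seqs"
  shows "(\<lambda>i. inv (h i)) \<in> H_seqs"
proof -
  have hG: "h i \<in> carrier G" for i using h by (simp add: H_carrier)
  have "dst (inv (h i)) \<one> = dst (h i) \<one>" for i
    using word_dist_translate[OF is_group S, of "h i" "inv (h i)" \<one>] hG[of i]
    by (simp add: W.commute)
  then show ?thesis
    using h hG subgroup.m_inv_closed[OF H] by (simp add: cone_sequences_def)
qed

text \<open>Right multiplication by a sequence \<open>h\<close>, as a map on points of the cone, which are equivalence
  classes of sequences. For \<open>h\<close> with values in \<open>H\<close> the choice of a representative is irrelevant.\<close>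

definition translate :: "('i \<Rightarrow> 'g) \<Rightarrow> ('i \<Rightarrow> 'g) set \<Rightarrow> ('i \<Rightarrow> 'g) set" where
  "translate h X = cls (\<lambda>i. (SOME x. x \<in> X) i \<otimes> h i)"

lemma translate_cls:
  assumes x: "x \<in> seqs" and h: "h \<in> H_seqs"
  shows "translate h (cls x) = cls (\<lambda>i. x i \<otimes> h i)"
proof -
  define x' where "x' = (SOME x'. x' \<in> cls x)"
  have "x \<in> cls x"
    using equiv_class_self[OF equiv_cone_rel[OF cone_facts] x] .
  then have "x' \<in> cls x" unfolding x'_def by (rule someI[where P = "\<lambda>x'. x' \<in> cls x"])
  then have x': "x' \<in> seqs" "pdist x x' = 0" by (auto simp: cone_rel_def)
  have "pdist (\<lambda>i. x i \<otimes> h i) (\<lambda>i. x' i \<otimes> h i) = 0"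
    using x x' h by (simp add: cone_pdist_def dst_mult_central seqs_carrier)
  then have "cls (\<lambda>i. x i \<otimes> h i) = cls (\<lambda>i. x' i \<otimes> h i)"
    using x x' h by (simp add: cone_class_eq_iff[OF cone_facts] seqs_mult)
  then show ?thesis by (simp add: translate_def x'_def)
qed

lemma translate_translate:
  assumes x: "x \<in> seqs" and g: "g \<in> H_seqs" and h: "h \<in> H_seqs"
  shows "translate g (translate h (cls x)) = cls (\<lambda>i. x i \<otimes> (h i \<otimes> g i))"
proof -
  have hG: "h i \<in> carrier G" "g i \<in> carrier G" for i using g h by (simp_all add: H_carrier)
  have "(\<lambda>i. x i \<otimes> h i) \<in> seqs" using h by (intro seqs_mult[OF x]) simp
  then have "translate g (cls (\<lambda>i. x i \<otimes> h i)) = cls (\<lambda>i. (x i \<otimes> h i) \<otimes> g i)"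
    using g by (rule translate_cls)
  then show ?thesis
    unfolding translate_cls[OF x h] using seqs_carrier[OF x] hG by (simp add: m_assoc)
qed

sublocale translated_geodesic_space Con cdist "translate ` H_seqs"
proof
  fix X Y assume X: "X \<in> Con" and Y: "Y \<in> Con"
  show "\<exists>g. Con.geodesic g X Y"
    by (rule cone_geodesic_exists[OF cone_facts d_at_top word_geodesic_exists[OF is_group S] X Y])
next
  fix f X assume "f \<in> translate ` H_seqs" and X: "X \<in> Con"
  then obtain h where h: "h \<in> H_seqs" "f = translate h" by blast
  obtain x where x: "x \<in> seqs" "X = cls x" using X by (rule cone_cases[OF cone_facts])
  show "f X \<in> Con"
    using h x by (simp add: translate_cls cone_classI[OF cone_facts] seqs_mult)
  fix Y assume Y: "Y \<in> Con"
  obtain y where y: "y \<in> seqs" "Y = cls y" using Y by (rule cone_cases[OF cone_facts])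
  have "pdist (\<lambda>i. x i \<otimes> h i) (\<lambda>i. y i \<otimes> h i) = pdist x y"
    using h x y by (simp add: cone_pdist_def dst_mult_central seqs_carrier)
  then show "cdist (f X) (f Y) = cdist X Y"
    using h x y by (simp add: translate_cls cdist_cls seqs_mult)
next
  fix f f' assume "f \<in> translate ` H_seqs" "f' \<in> translate ` H_seqs"
  then obtain h h' where h: "h \<in> H_seqs" "f = translate h" "h' \<in> H_seqs" "f' = translate h'"
    by blast
  have "translate (\<lambda>i. h' i \<otimes> h i) X = f (f' X)" if X: "X \<in> Con" for X
  proof -
    obtain x where x: "x \<in> seqs" "X = cls x" using X by (rule cone_cases[OF cone_facts])
    show ?thesis
      unfolding x(2) h(2,4) translate_translate[OF x(1) h(1,3)]
      by (rule translate_cls[OF x(1) H_seqs_mult[OF h(3,1)]])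
  qed
  then show "\<exists>k\<in>translate ` H_seqs. \<forall>X\<in>Con. k X = f (f' X)"
    using H_seqs_mult[OF h(3,1)] by blast
next
  fix f assume "f \<in> translate ` H_seqs"
  then obtain h where h: "h \<in> H_seqs" "f = translate h" by blast
  let ?h' = "\<lambda>i. inv (h i)"
  have hG: "h i \<in> carrier G" for i using h by (simp add: H_carrier)
  have "translate ?h' (f X) = X \<and> f (translate ?h' X) = X" if X: "X \<in> Con" for X
  proof -
    obtain x where x: "x \<in> seqs" "X = cls x" using X by (rule cone_cases[OF cone_facts])
    show ?thesis
      unfolding x(2) h(2) translate_translate[OF x(1) h(1) H_seqs_inv[OF h(1)]]
        translate_translate[OF x(1) H_seqs_inv[OF h(1)] h(1)]
      using x(1) hG by (simp add: seqs_carrier)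
  qed
  then show "\<exists>k\<in>translate ` H_seqs. \<forall>X\<in>Con. k (f X) = X \<and> f (k X) = X"
    using H_seqs_inv[OF h(1)] by blast
next
  fix r :: real assume r: "r > 0"
  \<comment> \<open>multiplication by elements of \<open>H\<close> of length about \<open>r * d i\<close> displaces every point
    of the cone by \<open>r\<close>\<close>
  have "\<forall>i. \<exists>h\<in>H. r * d i \<le> real (word_length G S h) \<and> real (word_length G S h) \<le> r * d i + c"
    using lengths r d by (simp add: less_imp_le)
  then obtain h where h: "\<And>i. h i \<in> H" "\<And>i. r * d i \<le> real (word_length G S (h i))"
    "\<And>i. real (word_length G S (h i)) \<le> r * d i + c"
    by metis
  have hG: "h i \<in> carrier G" for i using h(1) by (rule H_carrier)
  have len: "\<bar>real (word_length G S (h i)) - r * d i\<bar> \<le> c" for i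
    using h(2,3)[of i] by linarith
  note h_seq = seqs_of_length[OF hG len less_imp_le[OF r]]
  have hH: "h \<in> H_seqs" using h_seq(1) h(1) by simp
  have "cdist X (translate h X) = r" if X: "X \<in> Con" for X
  proof -
    obtain x where x: "x \<in> seqs" "X = cls x" using X by (rule cone_cases[OF cone_facts])
    have "cdist X (translate h X) = pdist x (\<lambda>i. x i \<otimes> h i)"
      unfolding x(2) translate_cls[OF x(1) hH] using x(1) h_seq(1) by (simp add: cdist_cls seqs_mult)
    also have "\<dots> = r" by (rule pdist_mult_right[OF x(1) hG h_seq(2)])
    finally show ?thesis .
  qed
  then show "\<exists>f\<in>translate ` H_seqs. \<forall>X\<in>Con. cdist X (f X) = r"
    using hH by blast
next
  fix X Y assume X: "X \<in> Con" and Y: "Y \<in> Con" and off: "X \<notin> (\<lambda>f. f Y) ` translate ` H_seqs"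
  obtain x where x: "x \<in> seqs" "X = cls x" using X by (rule cone_cases[OF cone_facts])
  obtain y where y: "y \<in> seqs" "Y = cls y" using Y by (rule cone_cases[OF cone_facts])
  \<comment> \<open>distances are natural numbers, so the coset of \<open>y i\<close> has a point nearest to \<open>x i\<close>; the
    sequence of these points realises the distance from \<open>X\<close> to the orbit of \<open>Y\<close>, which is then
    positive\<close>
  have "\<exists>h\<in>H. \<forall>h'\<in>H. dst (x i) (y i \<otimes> h) \<le> dst (x i) (y i \<otimes> h')" for i
  proof -
    let ?l = "\<lambda>h. word_length G S (inv (x i) \<otimes> (y i \<otimes> h))"
    obtain h where h: "h \<in> H" "\<And>h'. h' \<in> H \<Longrightarrow> ?l h \<le> ?l h'"
      using ex_has_least_nat[where P = "\<lambda>h. h \<in> H" and m = ?l] subgroup.one_closed[OF H] by blast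
    show ?thesis
    proof (intro bexI[OF _ h(1)] ballI)
      show "dst (x i) (y i \<otimes> h) \<le> dst (x i) (y i \<otimes> h')" if "h' \<in> H" for h'
        using that h x(1) y(1) by (simp add: word_dist_def seqs_carrier H_carrier)
    qed
  qed
  then obtain h where h: "\<And>i. h i \<in> H" "\<And>i h'. h' \<in> H \<Longrightarrow> dst (x i) (y i \<otimes> h i) \<le> dst (x i) (y i \<otimes> h')"
    by metis
  have hG: "h i \<in> carrier G" for i using h(1) by (rule H_carrier)
  have "h \<in> seqs"
  proof (rule cone_sequences_near[OF cone_facts const_one_seqs hG])
    show "((\<lambda>i. 2 * dst (x i) (y i) / d i) \<longlongrightarrow> 2 * pdist x y) \<omega>"
      using tendsto_mult_left[OF cone_pdist_tendsto[OF cone_facts x(1) y(1)], of 2] by simp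
    show "dst \<one> (h i) \<le> 2 * dst (x i) (y i)" for i
    proof -
      have m: "x i \<in> carrier G" "y i \<in> carrier G" "y i \<otimes> h i \<in> carrier G"
        using x(1) y(1) hG by (simp_all add: seqs_carrier)
      have "dst \<one> (h i) = dst (y i) (y i \<otimes> h i)"
        using m hG by (simp add: word_dist_one[OF is_group S] word_dist_mult_right[OF is_group S])
      also have "\<dots> \<le> dst (y i) (x i) + dst (x i) (y i \<otimes> h i)" by (rule W.triangle[OF m(2,1,3)])
      also have "dst (x i) (y i \<otimes> h i) \<le> dst (x i) (y i)"
        using h(2)[OF subgroup.one_closed[OF H], of i] m by simp
      finally show ?thesis by (simp add: W.commute)
    qed
  qed
  then have hH: "h \<in> H_seqs" using h(1) by simp
  have yh: "(\<lambda>i. y i \<otimes> h' i) \<in> seqs" if "h' \<in> H_seqs" for h'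
    using that y(1) by (simp add: seqs_mult)
  have tY: "translate h' Y = cls (\<lambda>i. y i \<otimes> h' i)" if "h' \<in> H_seqs" for h'
    unfolding y(2) by (rule translate_cls[OF y(1) that])
  have "X \<noteq> translate h Y" using off hH by blast
  then have "0 < cdist X (translate h Y)"
    using X yh[OF hH] by (simp add: tY[OF hH] cone_classI[OF cone_facts])
  moreover have "cdist X (translate h Y) \<le> cdist X (translate h' Y)" if h': "h' \<in> H_seqs" for h'
    unfolding tY[OF hH] tY[OF h'] x(2) cdist_cls[OF x(1) yh[OF hH]] cdist_cls[OF x(1) yh[OF h']]
    by (rule cone_pdist_mono[OF cone_facts x(1) yh[OF hH] x(1) yh[OF h']]) (use h(2) h' in simp)
  ultimately show "\<exists>\<delta>>0. \<forall>f\<in>translate ` H_seqs. \<delta> \<le> cdist X (f Y)" by blast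
next
  fix X assume X: "X \<in> Con"
  obtain x where x: "x \<in> seqs" "X = cls x" using X by (rule cone_cases[OF cone_facts])
  \<comment> \<open>multiplication by elements of length about \<open>d i\<close> far from \<open>H\<close> gives a point at distance 1 from \<open>X\<close>\<close>
  have "\<forall>i. \<exists>g\<in>carrier G. word_length G S g = nat \<lceil>d i\<rceil> \<and>
      (\<forall>h\<in>H. real (nat \<lceil>d i\<rceil>) \<le> dst g h)"
    using far by blast
  then obtain g where g: "\<And>i. g i \<in> carrier G" "\<And>i. word_length G S (g i) = nat \<lceil>d i\<rceil>"
    "\<And>i h. h \<in> H \<Longrightarrow> real (nat \<lceil>d i\<rceil>) \<le> dst (g i) h"
    by metis
  have len: "\<bar>real (word_length G S (g i)) - 1 * d i\<bar> \<le> 1" for i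
    using d[of i] by (simp add: g(2)) linarith
  note g_seq = seqs_of_length[OF g(1) len zero_le_one]
  let ?w = "\<lambda>i. x i \<otimes> g i"
  have w: "?w \<in> seqs" by (rule seqs_mult[OF x(1) g_seq(1)])
  have "cdist X (cls ?w) = 1"
    unfolding x(2) cdist_cls[OF x(1) w] by (rule pdist_mult_right[OF x(1) g(1) g_seq(2)])
  then have "cls ?w \<noteq> X" using X by auto
  moreover have "cdist X (cls ?w) \<le> cdist (cls ?w) (translate h X)" if h: "h \<in> H_seqs" for h
  proof -
    have hH: "h \<in> seqs" "h i \<in> H" for i using h by simp_all
    have xh: "(\<lambda>i. x i \<otimes> h i) \<in> seqs" by (rule seqs_mult[OF x(1) hH(1)])
    have "dst (x i) (?w i) = real (nat \<lceil>d i\<rceil>)" for i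
      using seqs_carrier[OF x(1)] g(1,2) by (simp add: word_dist_mult_right[OF is_group S])
    moreover have "dst (?w i) (x i \<otimes> h i) = dst (g i) (h i)" for i
      by (rule word_dist_translate[OF is_group S seqs_carrier[OF x(1)] g(1) H_carrier[OF hH(2)]])
    ultimately have "dst (x i) (?w i) \<le> dst (?w i) (x i \<otimes> h i)" for i
      using g(3)[OF hH(2)] by simp
    then show ?thesis
      unfolding x(2) translate_cls[OF x(1) h] cdist_cls[OF x(1) w] cdist_cls[OF w xh]
      by (rule cone_pdist_mono[OF cone_facts x(1) w w xh])
  qed
  ultimately show "\<exists>W\<in>Con. W \<noteq> X \<and> (\<forall>f\<in>translate ` H_seqs. cdist X W \<le> cdist W (f X))"
    using cone_classI[OF cone_facts w] by blast
qed

end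

section \<open>Wideness\<close>

theorem theorem6p5:
  fixes G :: "('g, 'b) monoid_scheme" and H :: "'g set"
  assumes "finitely_generated_group G"
    and "\<not> virtually_cyclic G"
    and "subgroup H G"
    and "\<forall>h\<in>H. \<forall>g\<in>carrier G. h \<otimes>\<^bsub>G\<^esub> g = g \<otimes>\<^bsub>G\<^esub> h"
    and "cyclic_group (G\<lparr>carrier := H\<rparr>)"
    and "infinite H"
  shows "wide TYPE('i::countable) G"
  unfolding wide_def
proof (intro allI impI, elim conjE)
  fix S and \<omega> :: "'i filter" and d :: "'i \<Rightarrow> real"
  assume S: "finite S" "generates G S" and \<omega>: "nonprincipal_ultrafilter \<omega>"
    and d: "\<forall>i. 0 < d i" "filterlim d at_top \<omega>"
  have G: "group G" using assms(1) by (simp add: finitely_generated_group_def)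
  obtain c where c: "\<forall>r\<ge>0. \<exists>h\<in>H. r \<le> real (word_length G S h) \<and> real (word_length G S h) \<le> r + c"
    using infinite_cyclic_subgroup_lengths[OF G S(2,1) assms(3,5,6)] by blast
  \<comment> \<open>otherwise \<open>H\<close> itself would be a cyclic subgroup of finite index\<close>
  have index: "infinite (rcosets\<^bsub>G\<^esub> H)"
    using assms(2,3,5) unfolding virtually_cyclic_def by blast
  interpret central_subgroup_cone G S H \<omega> d c
  proof (intro central_subgroup_cone.intro central_subgroup_cone_axioms.intro)
    show "ultrafilter \<omega>" using \<omega> by (simp add: nonprincipal_ultrafilter_def)
    show "h \<otimes>\<^bsub>G\<^esub> g = g \<otimes>\<^bsub>G\<^esub> h" if "h \<in> H" "g \<in> carrier G" for h g using assms(4) that by blast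
    show "\<exists>h\<in>H. r \<le> real (word_length G S h) \<and> real (word_length G S h) \<le> r + c" if "0 \<le> r" for r
      using c that by blast
    show "\<exists>g\<in>carrier G. word_length G S g = m \<and> (\<forall>h\<in>H. real m \<le> word_dist G S g h)" for m
      by (rule infinite_index_far_elements[OF G S(2,1) assms(3) index])
    show "0 < d i" for i using d(1) by blast
  qed (fact G S(2) assms(3) d(2))+
  show "\<not> has_global_cut_point (cone_topology (carrier G) (word_dist G S) \<omega> (\<lambda>_. \<one>\<^bsub>G\<^esub>) d)"
    unfolding cone_topology_def by (rule no_global_cut_point)
qed

end
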